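(* Let $r>0$ and $a>0$ be fixed, and for $s\in\mathbb N$ and $\varepsilon\in(0,1]$ let $n_\varepsilon=n_\varepsilon(U^{r,a}(\mathbb T^s),L_2(\mathbb T^s))$. (i) If $a>1$, the problem of $n_\varepsilon$ is exponentially tractable. Moreover, for any $q\in[2,\infty)$ such that $\lambda:=a-2/q>1$, any $s\in\mathbb N$ and any $\varepsilon\in(0,1]$, $$n_\varepsilon\le q\,\lambda^{-qs}\,\varepsilon^{-(1+q)/r},$$ and the exponent of exponential tractability satisfies $$p^{\exp}\le\begin{cases}3/r, & a\ge 2,\\ \bigl(1+2/(a-1)\bigr)/r, & a<2.\end{cases}$$ (ii) If $a=1$, the problem of $n_\varepsilon$ is weakly tractable but polynomially intractable. (iii) If $a<1$, the problem of $n_\varepsilon$ is intractable.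
   Context: $\mathbb N=\{1,2,\dots\}$. $\mathbb T^s=[-\pi,\pi]^s$ is the $s$-dimensional torus, and $L_2(\mathbb T^s)$ carries the inner product $(f,g)=(2\pi)^{-s}\int_{\mathbb T^s}f(\mathbf x)\overline{g(\mathbf x)}\,d\mathbf x$ and norm $\|f\|=(f,f)^{1/2}$. For $\mathbf k\in\mathbb Z^s$, $e_{\mathbf k}(\mathbf x)=e^{i(\mathbf k,\mathbf x)}$, $\hat f(\mathbf k)=(f,e_{\mathbf k})$. For $a>0$ put $\lambda_a(\mathbf k):=\prod_{j=1}^s(a+|k_j|)$. The modified Korobov space $K^{r,a}(\mathbb T^s)$ is the Hilbert space of all $f=\kappa_{r,a}*g$ with $g\in L_2(\mathbb T^s)$, where $\kappa_{r,a}=\sum_{\mathbf k\in\mathbb Z^s}\lambda_a(\mathbf k)^{-r}e_{\mathbf k}$ (in the distributional sense), i.e. $\hat f(\mathbf k)=\lambda_a(\mathbf k)^{-r}\hat g(\mathbf k)$, with norm $\|f\|_{K^{r,a}(\mathbb T^s)}:=\|g\|$; equivalently $\|f\|^2_{K^{r,a}(\mathbb T^s)}=\sum_{\mathbf k}\lambda_a(\mathbf k)^{2r}|\hat f(\mathbf k)|^2$. $U^{r,a}(\mathbb T^s)$ is its (closed) unit ball. For a normed space $X$ and $W\subset X$ centrally symmetric, $n_\varepsilon(W,X)$ is the smallest $n\in\mathbb N_0$ such that some linear subspace $L\subset X$ of dimension $\le n$ satisfies $\sup_{f\in W}\inf_{g\in L}\|f-g\|_X\le\varepsilon$. Tractability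 notions for a family $W=W_s\subset L_2(\mathbb T^s)$, $s\in\mathbb N$, with $n_\varepsilon=n_\varepsilon(W_s,L_2(\mathbb T^s))$, $\varepsilon\in(0,1]$. The problem is: weakly tractable if $\lim_{\varepsilon^{-1}+s\to\infty}\frac{\ln n_\varepsilon}{\varepsilon^{-1}+s}=0$ (with the convention $\ln 0:=0$), and intractable if this equation does not hold; polynomially tractable if there are nonnegative $C,p,q$ with $n_\varepsilon\le C s^q\varepsilon^{-p}$ for all $\varepsilon\in(0,1]$, $s\in\mathbb N$, and polynomially intractable otherwise; exponentially tractable if there are nonnegative $C,p$ and a positive $q$ with $n_\varepsilon\le C e^{-qs}\varepsilon^{-p}$ for all $\varepsilon\in(0,1]$, $s\in\mathbb N$. In the last case the exponent of exponential tractability $p^{\exp}$ is the infimum of all $p\geq 0$ for which this inequality holds for some $C\ge0$ and $q>0$. *)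

theory Defs
  imports "HOL-Analysis.Analysis" "HOL-Library.Function_Algebras"
begin

section \<open>The space \<open>L\<^sub>2\<close> on the \<open>s\<close>-dimensional torus\<close>

text \<open>
  As the dimension \<open>s\<close> is a variable, points of the torus are functions on the index set
  \<open>{1..s}\<close> (extended by \<open>undefined\<close>), and so are the frequencies in \<open>\<int>\<^sup>s\<close>.
\<close>

definition torus_measure :: "nat \<Rightarrow> (nat \<Rightarrow> real) measure" where
  "torus_measure s = (\<Pi>\<^sub>M j\<in>{1..s}. restrict_space lborel {-pi..pi})"

definition int_lattice :: "nat \<Rightarrow> (nat \<Rightarrow> int) set" where
  "int_lattice s = (\<Pi>\<^sub>E j\<in>{1..s}. UNIV)"

text \<open>
  Elements of \<open>L\<^sub>2\<close> are represented by square-integrable functions, without passing to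
  classes modulo equality almost everywhere; consequently \<open>L2_norm s\<close> is a seminorm.
\<close>

definition L2_space :: "nat \<Rightarrow> ((nat \<Rightarrow> real) \<Rightarrow> complex) set" where
  "L2_space s = {f \<in> borel_measurable (torus_measure s).
     integrable (torus_measure s) (\<lambda>x. (norm (f x))\<^sup>2)}"

definition L2_inner ::
  "nat \<Rightarrow> ((nat \<Rightarrow> real) \<Rightarrow> complex) \<Rightarrow> ((nat \<Rightarrow> real) \<Rightarrow> complex) \<Rightarrow> complex" where
  "L2_inner s f g = (LINT x|torus_measure s. f x * cnj (g x)) / (2 * of_real pi) ^ s"

definition L2_norm :: "nat \<Rightarrow> ((nat \<Rightarrow> real) \<Rightarrow> complex) \<Rightarrow> real" where
  "L2_norm s f = sqrt (Re (L2_inner s f f))"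

definition trig_char :: "nat \<Rightarrow> (nat \<Rightarrow> int) \<Rightarrow> (nat \<Rightarrow> real) \<Rightarrow> complex" where
  "trig_char s k x = exp (\<i> * of_real (\<Sum>j\<in>{1..s}. real_of_int (k j) * x j))"

definition fourier_coeff ::
  "nat \<Rightarrow> ((nat \<Rightarrow> real) \<Rightarrow> complex) \<Rightarrow> (nat \<Rightarrow> int) \<Rightarrow> complex" where
  "fourier_coeff s f k = L2_inner s f (trig_char s k)"

section \<open>Modified Korobov spaces\<close>

definition korobov_weight :: "nat \<Rightarrow> real \<Rightarrow> (nat \<Rightarrow> int) \<Rightarrow> real" where
  "korobov_weight s a k = (\<Prod>j\<in>{1..s}. (a + real_of_int \<bar>k j\<bar>))"

text \<open>
  The equation \<open>f = \<kappa>\<^bsub>r,a\<^esub> * g\<close>, where the convolution with the distribution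
  \<open>\<kappa>\<^bsub>r,a\<^esub>\<close> is given by its action on Fourier coefficients. For \<open>a > 0\<close> the multipliers
  are bounded, so that \<open>f\<close> is in \<open>L\<^sub>2\<close> whenever \<open>g\<close> is.
\<close>

definition is_korobov_conv ::
  "nat \<Rightarrow> real \<Rightarrow> real \<Rightarrow> ((nat \<Rightarrow> real) \<Rightarrow> complex) \<Rightarrow> ((nat \<Rightarrow> real) \<Rightarrow> complex) \<Rightarrow> bool" where
  "is_korobov_conv s r a f g \<longleftrightarrow>
     (\<forall>k\<in>int_lattice s.
        fourier_coeff s f k = of_real (korobov_weight s a k powr (- r)) * fourier_coeff s g k)"

definition korobov_space :: "nat \<Rightarrow> real \<Rightarrow> real \<Rightarrow> ((nat \<Rightarrow> real) \<Rightarrow> complex) set" where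
  "korobov_space s r a = {f \<in> L2_space s. \<exists>g\<in>L2_space s. is_korobov_conv s r a f g}"

text \<open>
  For \<open>f\<close> in the Korobov space with \<open>a > 0\<close>, the function \<open>g\<close> is unique up to equality
  almost everywhere, so its norm is unique.
\<close>

definition korobov_norm :: "nat \<Rightarrow> real \<Rightarrow> real \<Rightarrow> ((nat \<Rightarrow> real) \<Rightarrow> complex) \<Rightarrow> real" where
  "korobov_norm s r a f =
     (THE c. \<exists>g\<in>L2_space s. is_korobov_conv s r a f g \<and> c = L2_norm s g)"

definition korobov_ball :: "nat \<Rightarrow> real \<Rightarrow> real \<Rightarrow> ((nat \<Rightarrow> real) \<Rightarrow> complex) set" where
  "korobov_ball s r a = {f \<in> korobov_space s r a. korobov_norm s r a f \<le> 1}"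

section \<open>The quantity \<open>n\<^sub>\<epsilon>(W, X)\<close>\<close>

interpretation cfun: vector_space "\<lambda>(c::complex) (f :: 'a \<Rightarrow> complex) x. c * f x"
  by unfold_locales (auto simp: fun_eq_iff algebra_simps)

text \<open>
  A subspace of dimension at most \<open>n\<close> is written as a span of at most \<open>n\<close> vectors, because
  the library's \<open>dim\<close> is \<open>0\<close> on infinite-dimensional spaces. If \<open>nrm\<close> is only a seminorm
  (as for \<open>L2_norm\<close>), the resulting number is that of the quotient by the null vectors:
  subspaces of the quotient of dimension at most \<open>n\<close> are exactly the images of spans of at
  most \<open>n\<close> representatives. The value is \<open>\<infinity>\<close> if no finite dimension suffices.
\<close>

definition n_eps ::
  "('a \<Rightarrow> complex) set \<Rightarrow> (('a \<Rightarrow> complex) \<Rightarrow> real) \<Rightarrow> ('a \<Rightarrow> complex) set \<Rightarrow> real \<Rightarrow> enat" where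
  "n_eps X nrm W \<epsilon> =
     Inf {enat n | n. \<exists>L. L \<subseteq> X \<and> (\<exists>B. finite B \<and> card B \<le> n \<and> L = cfun.span B) \<and>
       (SUP f\<in>W. INF g\<in>L. ereal (nrm (f - g))) \<le> ereal \<epsilon>}"

definition n_eps_korobov :: "real \<Rightarrow> real \<Rightarrow> nat \<Rightarrow> real \<Rightarrow> enat" where
  "n_eps_korobov r a s \<epsilon> = n_eps (L2_space s) (L2_norm s) (korobov_ball s r a) \<epsilon>"

section \<open>Tractability\<close>

text \<open>In this section \<open>n s \<epsilon>\<close> stands for \<open>n\<^sub>\<epsilon>(W\<^sub>s, L\<^sub>2(T\<^sup>s))\<close>; only \<open>s \<ge> 1\<close> and
  \<open>0 < \<epsilon> \<le> 1\<close> matter.\<close>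

definition ln_enat :: "enat \<Rightarrow> ereal" where
  "ln_enat N = (case N of enat m \<Rightarrow> ereal (if m = 0 then 0 else ln (real m)) | \<infinity> \<Rightarrow> \<infinity>)"

definition weakly_tractable :: "(nat \<Rightarrow> real \<Rightarrow> enat) \<Rightarrow> bool" where
  "weakly_tractable n \<longleftrightarrow>
     ((\<lambda>(\<epsilon>, s). ln_enat (n s \<epsilon>) / ereal (1 / \<epsilon> + real s)) \<longlongrightarrow> 0)
       (inf (filtercomap (\<lambda>(\<epsilon>, s). 1 / \<epsilon> + real s) at_top) (principal ({0<..1} \<times> {1..})))"

definition intractable :: "(nat \<Rightarrow> real \<Rightarrow> enat) \<Rightarrow> bool" where
  "intractable n \<longleftrightarrow> \<not> weakly_tractable n"

definition polynomially_tractable :: "(nat \<Rightarrow> real \<Rightarrow> enat) \<Rightarrow> bool" where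
  "polynomially_tractable n \<longleftrightarrow>
     (\<exists>C p q. C \<ge> 0 \<and> p \<ge> 0 \<and> q \<ge> 0 \<and>
       (\<forall>\<epsilon>\<in>{0<..1}. \<forall>s\<ge>1.
          ereal_of_enat (n s \<epsilon>) \<le> ereal (C * real s powr q * \<epsilon> powr (- p))))"

definition polynomially_intractable :: "(nat \<Rightarrow> real \<Rightarrow> enat) \<Rightarrow> bool" where
  "polynomially_intractable n \<longleftrightarrow> \<not> polynomially_tractable n"

definition exp_tractability_bound :: "(nat \<Rightarrow> real \<Rightarrow> enat) \<Rightarrow> real \<Rightarrow> real \<Rightarrow> real \<Rightarrow> bool" where
  "exp_tractability_bound n C p q \<longleftrightarrow>
     (\<forall>\<epsilon>\<in>{0<..1}. \<forall>s\<ge>1.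
        ereal_of_enat (n s \<epsilon>) \<le> ereal (C * exp (- q * real s) * \<epsilon> powr (- p)))"

definition exponentially_tractable :: "(nat \<Rightarrow> real \<Rightarrow> enat) \<Rightarrow> bool" where
  "exponentially_tractable n \<longleftrightarrow>
     (\<exists>C p q. C \<ge> 0 \<and> p \<ge> 0 \<and> q > 0 \<and> exp_tractability_bound n C p q)"

text \<open>Meaningful only if \<open>exponentially_tractable n\<close>, i.e. if the set is nonempty.\<close>

definition exp_tractability_exponent :: "(nat \<Rightarrow> real \<Rightarrow> enat) \<Rightarrow> real" where
  "exp_tractability_exponent n =
     Inf {p. p \<ge> 0 \<and> (\<exists>C q. C \<ge> 0 \<and> q > 0 \<and> exp_tractability_bound n C p q)}"

end

(* By Parseval's identity the characters diagonalize the embedding of the Korobov space into L2, with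
   singular values lambda(k)^(-r). Truncating the Fourier series, and conversely testing a competing
   subspace with a trigonometric polynomial orthogonal to it, shows that n_eps is the number of
   frequencies k with lambda(k)^(-r) > eps. This number is bounded above by Rankin's trick and below
   by counting the frequencies with exactly t coordinates equal to 1 and all others 0.

   The completeness of the characters rests on the algebra of bounded multipliers preserving the
   L2-closure of the trigonometric polynomials. It is closed under bounded pointwise limits, and a
   half-space {x_j > c} is, up to a null set, a superlevel set of cos (x_j - m) on [-pi, pi]; so the
   Weierstrass theorem puts half-space indicators, hence all indicators, into the algebra. *)

theory Submission
  imports Defs
begin

section \<open>The torus measure and orthonormality of the characters\<close>

text \<open>Indicators of intersections require products, and a product of two elements of an
  L2-closure need not be square-integrable; multipliers of the closure, in contrast, compose freely.
  The exponent in Rankin's trick is written 1 + q because the sum over one integer coordinate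
  converges exactly for exponents above 1. That sum is at most a^(-q) (1/a + 2/q), and the s-th
  power of this factor decides the regime. For a > 1 and admissible q the factor is at most (a -
  2/q)^(-q) < 1, which gives the decay in s and ties the power (1 + q)/r of 1/\<epsilon> to q. For a
  = 1 it is 1 + 2/q, which tends to 1 as q grows: enough for weak tractability. For a < 1 each zero
  coordinate has weight below 1 and so compensates for nonzero ones; already at \<epsilon> = 1
  exponentially many frequencies survive.\<close>

lemma product_sigma_finite_torus:
  "product_sigma_finite (\<lambda>j::nat. restrict_space lborel {-pi..pi})"
  by (auto intro!: product_sigma_finite.intro sigma_finite_measure_restrict_space lborel.sigma_finite_measure_axioms)

lemma space_torus_measure: "space (torus_measure s) = (\<Pi>\<^sub>E j\<in>{1..s}. {-pi..pi})"
  by (simp add: torus_measure_def space_PiM space_restrict_space)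

lemma finite_measure_torus: "finite_measure (torus_measure s)"
proof
  interpret product_sigma_finite "\<lambda>j::nat. restrict_space lborel {-pi..pi}"
    by (rule product_sigma_finite_torus)
  have "{-pi..pi} \<in> sets (restrict_space lborel {-pi..pi})"
    by (simp add: sets_restrict_space_iff)
  then have "emeasure (torus_measure s) (space (torus_measure s))
      = (\<Prod>j\<in>{1..s}. emeasure (restrict_space lborel {-pi..pi}) {-pi..pi})"
    unfolding space_torus_measure unfolding torus_measure_def by (intro emeasure_PiM finite_atLeastAtMost)
  also have "\<dots> = ennreal (2 * pi) ^ s"
    by (simp add: emeasure_restrict_space)
  finally show "emeasure (torus_measure s) (space (torus_measure s)) \<noteq> \<infinity>"
    by (simp add: ennreal_power)
qed

lemma measurable_component_torus [measurable]:
  "j \<in> {1..s} \<Longrightarrow> (\<lambda>x. x j) \<in> borel_measurable (torus_measure s)"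
proof -
  assume j: "j \<in> {1..s}"
  have "(\<lambda>x. x j) \<in> measurable (torus_measure s) (restrict_space lborel {-pi..pi::real})"
    unfolding torus_measure_def by (rule measurable_component_singleton[OF j])
  then show ?thesis
    by (simp add: measurable_restrict_space2_iff)
qed

text \<open>A hyperplane lies in a box with one degenerate side, and the measure of a box is a
  product. This is needed because the cosine criterion for half-spaces fails at
  \<open>x j = pi\<close>.\<close>

lemma AE_torus_component_neq:
  assumes j: "j \<in> {1..s}"
  shows "AE x in torus_measure s. x j \<noteq> c"
proof -
  interpret product_sigma_finite "\<lambda>j::nat. restrict_space lborel {-pi..pi}"
    by (rule product_sigma_finite_torus)
  define A where "A = (\<lambda>i. if i = j then {c} \<inter> {-pi..pi} else {-pi..pi})"
  have A: "A i \<in> sets (restrict_space lborel {-pi..pi})" for i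
    by (simp add: A_def sets_restrict_space_iff sets.Int)
  have "emeasure (torus_measure s) (Pi\<^sub>E {1..s} A)
      = (\<Prod>i\<in>{1..s}. emeasure (restrict_space lborel {-pi..pi}) (A i))"
    unfolding torus_measure_def by (rule emeasure_PiM) (simp_all only: A finite_atLeastAtMost)
  also have "\<dots> = 0"
    using j by (auto intro!: bexI[of _ j] simp: A_def emeasure_restrict_space emeasure_lborel_countable)
  finally have 0: "emeasure (torus_measure s) (Pi\<^sub>E {1..s} A) = 0" .
  have "Pi\<^sub>E {1..s} A \<in> sets (torus_measure s)"
    unfolding torus_measure_def using A by (intro sets_PiM_I_finite) auto
  moreover have "{x \<in> space (torus_measure s). \<not> x j \<noteq> c} \<subseteq> Pi\<^sub>E {1..s} A"
    by (auto simp: space_torus_measure A_def PiE_iff extensional_def)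
  ultimately show ?thesis
    using 0 by (intro AE_I) auto
qed

lemma integral_exp_interval:
  fixes k :: int
  shows "integrable (restrict_space lborel {-pi..pi}) (\<lambda>t. exp (\<i> * of_real (of_int k * t)))"
    and "(LINT t|restrict_space lborel {-pi..pi}. exp (\<i> * of_real (of_int k * t)))
           = (if k = 0 then 2 * of_real pi else 0)"
proof -
  let ?f = "\<lambda>t. exp (\<i> * of_real (of_int k * t)) :: complex"
  have c: "continuous_on {-pi..pi} ?f"
    by (intro continuous_intros)
  have "set_integrable lborel {-pi..pi} ?f"
    by (rule borel_integrable_atLeastAtMost') (rule c)
  then show i: "integrable (restrict_space lborel {-pi..pi}) ?f"
    by (simp add: set_integrable_def integrable_restrict_space)
  show "(LINT t|restrict_space lborel {-pi..pi}. ?f t) = (if k = 0 then 2 * of_real pi else 0)"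
  proof (cases "k = 0")
    case True
    then show ?thesis
      by (simp add: integral_restrict_space measure_restrict_space scaleR_conv_of_real)
  next
    case False
    let ?F = "\<lambda>t. exp (\<i> * of_real (of_int k * t)) / (\<i> * of_int k)"
    have "(?F has_vector_derivative ?f t) (at t within {-pi..pi})" for t
    proof -
      have "((\<lambda>z. exp (\<i> * (of_int k * z)) / (\<i> * of_int k)) has_field_derivative
              exp (\<i> * (of_int k * of_real t))) (at (of_real t))"
        using False by (auto intro!: derivative_eq_intros simp: divide_simps mult_ac)
      then have "((\<lambda>z. exp (\<i> * (of_int k * of_real z)) / (\<i> * of_int k)) has_vector_derivative
              exp (\<i> * (of_int k * of_real t))) (at t)"
        by (rule has_vector_derivative_real_field)
      then show ?thesis
        by (auto intro: has_vector_derivative_at_within)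
    qed
    then have "integral\<^sup>L lborel (\<lambda>t. indicator {-pi..pi} t *\<^sub>R ?f t) = ?F pi - ?F (-pi)"
      by (intro integral_FTC_Icc c) auto
    \<comment> \<open>The two arguments differ by \<open>k\<close> full periods, so the boundary
      terms cancel.\<close>
    also have "exp (\<i> * of_real (of_int k * pi)) = exp (\<i> * of_real (of_int k * (-pi)))"
      by (subst exp_eq) (auto intro!: exI[of _ k] simp: algebra_simps)
    finally show ?thesis
      using False by (simp add: integral_restrict_space)
  qed
qed

lemma trig_char_add: "trig_char s (\<lambda>j. k j + l j) x = trig_char s k x * trig_char s l x"
  by (simp add: trig_char_def exp_add[symmetric] distrib_left[symmetric] sum.distrib[symmetric] distrib_right)

lemma cnj_trig_char: "cnj (trig_char s k x) = trig_char s (\<lambda>j. - k j) x"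
  by (simp add: trig_char_def exp_cnj sum_negf)

lemma norm_trig_char [simp]: "norm (trig_char s k x) = 1"
  by (simp add: trig_char_def)

lemma trig_char_restrict: "trig_char s (restrict k {1..s}) = trig_char s k"
  by (rule ext) (simp add: trig_char_def cong: sum.cong_simp)

lemma restrict_int_lattice [simp]: "restrict k {1..s} \<in> int_lattice s"
  by (auto simp: int_lattice_def)

lemma measurable_trig_char [measurable]: "trig_char s k \<in> borel_measurable (torus_measure s)"
  unfolding trig_char_def by measurable auto

lemma integral_trig_char:
  "(LINT x|torus_measure s. trig_char s k x) = (if \<forall>j\<in>{1..s}. k j = 0 then (2 * of_real pi) ^ s else 0)"
proof -
  interpret product_sigma_finite "\<lambda>j::nat. restrict_space lborel {-pi..pi}"
    by (rule product_sigma_finite_torus)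
  have "(LINT x|torus_measure s. trig_char s k x) =
      (LINT x|torus_measure s. (\<Prod>j\<in>{1..s}. exp (\<i> * of_real (of_int (k j) * x j))))"
    by (intro Bochner_Integration.integral_cong refl)
       (simp add: trig_char_def exp_sum[symmetric] sum_distrib_left)
  also have "\<dots> = (\<Prod>j\<in>{1..s}. if k j = 0 then 2 * of_real pi else 0)"
    unfolding torus_measure_def
    by (subst product_integral_prod) (simp_all only: integral_exp_interval finite_atLeastAtMost)
  also have "\<dots> = (if \<forall>j\<in>{1..s}. k j = 0 then (2 * of_real pi) ^ s else 0)"
    by (auto intro!: prod_zero)
  finally show ?thesis .
qed

lemma L2_inner_trig_char:
  assumes "k \<in> int_lattice s" "l \<in> int_lattice s"
  shows "L2_inner s (trig_char s k) (trig_char s l) = (if k = l then 1 else 0)"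
proof -
  have "k = l \<longleftrightarrow> (\<forall>j\<in>{1..s}. k j = l j)"
    using assms by (metis int_lattice_def PiE_ext)
  then show ?thesis
    by (auto simp: L2_inner_def cnj_trig_char trig_char_add[symmetric] integral_trig_char)
qed

section \<open>Square-integrable functions\<close>

text \<open>A real integral without the factor (2 pi)^(-s), which does not affect density;
  \<open>L2_norm_sq\<close> restores it.\<close>

definition L2_sq :: "nat \<Rightarrow> ((nat \<Rightarrow> real) \<Rightarrow> complex) \<Rightarrow> real" where
  "L2_sq s f = (LINT x|torus_measure s. (norm (f x))\<^sup>2)"

lemma L2_sq_nonneg [simp]: "L2_sq s f \<ge> 0"
  by (simp add: L2_sq_def)

lemma L2_inner_self: "L2_inner s f f = of_real (L2_sq s f / (2 * pi) ^ s)"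
proof -
  have "L2_inner s f f = (LINT x|torus_measure s. of_real ((norm (f x))\<^sup>2)) / (2 * of_real pi) ^ s"
    by (simp only: L2_inner_def complex_norm_square)
  then show ?thesis
    unfolding L2_sq_def integral_complex_of_real by simp
qed

lemma L2_norm_sq: "(L2_norm s f)\<^sup>2 = L2_sq s f / (2 * pi) ^ s"
  by (simp add: L2_norm_def L2_inner_self del: of_real_divide of_real_mult of_real_power)

lemma L2_norm_nonneg [simp]: "L2_norm s f \<ge> 0"
  by (simp add: L2_norm_def L2_inner_self del: of_real_divide of_real_mult of_real_power)

lemma L2_spaceD:
  assumes "f \<in> L2_space s"
  shows "f \<in> borel_measurable (torus_measure s)" "integrable (torus_measure s) (\<lambda>x. (norm (f x))\<^sup>2)"
  using assms by (auto simp: L2_space_def)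

lemma L2_space_dominated:
  assumes [measurable]: "f \<in> borel_measurable (torus_measure s)" and g: "g \<in> L2_space s"
    and le: "AE x in torus_measure s. norm (f x) \<le> C * norm (g x)"
  shows "f \<in> L2_space s"
proof -
  have "integrable (torus_measure s) (\<lambda>x. C\<^sup>2 * (norm (g x))\<^sup>2)"
    using L2_spaceD[OF g] by simp
  then have "integrable (torus_measure s) (\<lambda>x. (norm (f x))\<^sup>2)"
  proof (rule Bochner_Integration.integrable_bound)
    show "AE x in torus_measure s. norm ((norm (f x))\<^sup>2) \<le> norm (C\<^sup>2 * (norm (g x))\<^sup>2)"
      using le by eventually_elim (simp add: abs_mult power_mult_distrib[symmetric] power_mono)
  qed simp
  then show ?thesis
    by (simp add: L2_space_def)
qed

lemma norm_add_sq_le: "(norm (a + b))\<^sup>2 \<le> 2 * (norm a)\<^sup>2 + 2 * (norm b)\<^sup>2"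
  for a b :: "'a :: real_normed_vector"
proof -
  have "(norm (a + b))\<^sup>2 \<le> (norm a + norm b)\<^sup>2"
    by (intro power_mono norm_triangle_ineq) simp
  also have "\<dots> \<le> 2 * (norm a)\<^sup>2 + 2 * (norm b)\<^sup>2"
    using sum_squares_bound[of "norm a" "norm b"] by (simp add: power2_sum)
  finally show ?thesis .
qed

lemma L2_space_add [intro]:
  assumes f: "f \<in> L2_space s" and g: "g \<in> L2_space s"
  shows "f + g \<in> L2_space s"
proof -
  note [measurable] = L2_spaceD(1)[OF f] L2_spaceD(1)[OF g]
  have "integrable (torus_measure s) (\<lambda>x. 2 * (norm (f x))\<^sup>2 + 2 * (norm (g x))\<^sup>2)"
    using L2_spaceD(2)[OF f] L2_spaceD(2)[OF g] by simp
  then have "integrable (torus_measure s) (\<lambda>x. (norm (f x + g x))\<^sup>2)"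
    by (rule Bochner_Integration.integrable_bound) (auto intro: norm_add_sq_le)
  then show ?thesis
    by (simp add: L2_space_def plus_fun_def)
qed

text \<open>Stand-in for the triangle inequality of the norm. Its factor 2 is the reason why
  approximations are requested with a quarter of the target error.\<close>

lemma L2_sq_add_le:
  assumes f: "f \<in> L2_space s" and g: "g \<in> L2_space s"
  shows "L2_sq s (f + g) \<le> 2 * L2_sq s f + 2 * L2_sq s g"
proof -
  have "L2_sq s (f + g) \<le> (LINT x|torus_measure s. 2 * (norm (f x))\<^sup>2 + 2 * (norm (g x))\<^sup>2)"
    unfolding L2_sq_def using L2_spaceD[OF f] L2_spaceD[OF g] L2_spaceD[OF L2_space_add[OF f g]]
    by (intro integral_mono) (auto intro: norm_add_sq_le)
  also have "\<dots> = 2 * L2_sq s f + 2 * L2_sq s g"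
    using L2_spaceD[OF f] L2_spaceD[OF g] by (simp add: L2_sq_def)
  finally show ?thesis .
qed

lemma L2_space_bounded_mult:
  assumes [measurable]: "\<phi> \<in> borel_measurable (torus_measure s)" and "\<And>x. norm (\<phi> x) \<le> C"
    and f: "f \<in> L2_space s"
  shows "(\<lambda>x. \<phi> x * f x) \<in> L2_space s"
proof (rule L2_space_dominated[OF _ f])
  note [measurable] = L2_spaceD(1)[OF f]
  show "(\<lambda>x. \<phi> x * f x) \<in> borel_measurable (torus_measure s)"
    by measurable
  show "AE x in torus_measure s. norm (\<phi> x * f x) \<le> C * norm (f x)"
    using assms by (auto simp: norm_mult intro!: mult_right_mono)
qed

lemma L2_space_scale [intro]: "f \<in> L2_space s \<Longrightarrow> (\<lambda>x. c * f x) \<in> L2_space s"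
  by (rule L2_space_bounded_mult[where C = "norm c"]) auto

lemma L2_space_diff [intro]:
  assumes f: "f \<in> L2_space s" and g: "g \<in> L2_space s"
  shows "f - g \<in> L2_space s"
proof -
  have "f - g = f + (\<lambda>x. (-1) * g x)"
    by (auto simp: fun_eq_iff)
  with f g show ?thesis
    by (simp only:) (intro L2_space_add L2_space_scale)
qed

lemma L2_space_bounded:
  assumes [measurable]: "f \<in> borel_measurable (torus_measure s)" and "\<And>x. norm (f x) \<le> C"
  shows "f \<in> L2_space s"
proof -
  interpret finite_measure "torus_measure s"
    by (rule finite_measure_torus)
  show ?thesis
    unfolding L2_space_def using assms
    by (auto intro!: integrable_const_bound[of _ "C\<^sup>2"] AE_I2 power_mono)
qed

lemma subspace_L2_space: "cfun.subspace (L2_space s)"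
  by (rule cfun.subspaceI) (auto simp: zero_fun_def intro: L2_space_bounded[where C = 0])

lemma L2_space_trig_char [intro, simp]: "trig_char s k \<in> L2_space s"
  by (rule L2_space_bounded[where C = 1]) auto

text \<open>The limit inherits the bound \<open>C * norm (g x)\<close>, so
  \<open>(2 * C)\<^sup>2 * (norm (g x))\<^sup>2\<close> dominates the squared differences.\<close>

lemma L2_dominated_convergence:
  assumes [measurable]: "f \<in> borel_measurable (torus_measure s)" "\<And>n. F n \<in> borel_measurable (torus_measure s)"
    and g: "g \<in> L2_space s"
    and lim: "AE x in torus_measure s. (\<lambda>n. F n x) \<longlonglongrightarrow> f x"
    and le: "\<And>n. AE x in torus_measure s. norm (F n x) \<le> C * norm (g x)"
  shows "f \<in> L2_space s" "(\<lambda>n. L2_sq s (f - F n)) \<longlonglongrightarrow> 0"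
proof -
  have all_le: "AE x in torus_measure s. \<forall>n. norm (F n x) \<le> C * norm (g x)"
    using le by (simp add: AE_all_countable)
  have f_le: "AE x in torus_measure s. norm (f x) \<le> C * norm (g x)"
    using lim all_le
  proof eventually_elim
    case (elim x)
    then show ?case
      by (intro tendsto_upperbound[OF tendsto_norm]) auto
  qed
  then show "f \<in> L2_space s"
    by (intro L2_space_dominated[OF _ g]) auto
  have "(\<lambda>n. LINT x|torus_measure s. (norm (f x - F n x))\<^sup>2) \<longlonglongrightarrow> (LINT x|torus_measure s. 0)"
  proof (rule integral_dominated_convergence[where w = "\<lambda>x. (2 * C)\<^sup>2 * (norm (g x))\<^sup>2"])
    show "integrable (torus_measure s) (\<lambda>x. (2 * C)\<^sup>2 * (norm (g x))\<^sup>2)"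
      using L2_spaceD[OF g] by simp
    show "AE x in torus_measure s. (\<lambda>n. (norm (f x - F n x))\<^sup>2) \<longlonglongrightarrow> 0"
      using lim
    proof eventually_elim
      case (elim x)
      have "(\<lambda>n. (norm (f x - F n x))\<^sup>2) \<longlonglongrightarrow> (norm (f x - f x))\<^sup>2"
        by (intro tendsto_intros elim)
      then show ?case by simp
    qed
    show "AE x in torus_measure s. norm ((norm (f x - F n x))\<^sup>2) \<le> (2 * C)\<^sup>2 * (norm (g x))\<^sup>2" for n
      using f_le all_le
    proof eventually_elim
      case (elim x)
      have "norm (f x - F n x) \<le> norm (f x) + norm (F n x)"
        by (rule norm_triangle_ineq4)
      also have "\<dots> \<le> 2 * C * norm (g x)"
        using elim(1) elim(2)[rule_format, of n] by simp
      finally have "(norm (f x - F n x))\<^sup>2 \<le> (2 * C * norm (g x))\<^sup>2"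
        by (intro power_mono) auto
      then show ?case
        by (simp add: power_mult_distrib)
    qed
  qed auto
  then show "(\<lambda>n. L2_sq s (f - F n)) \<longlonglongrightarrow> 0"
    by (simp add: L2_sq_def)
qed

section \<open>Density of trigonometric polynomials\<close>

definition trig_polys :: "nat \<Rightarrow> ((nat \<Rightarrow> real) \<Rightarrow> complex) set" where
  "trig_polys s = cfun.span (range (trig_char s))"

definition trig_closure :: "nat \<Rightarrow> ((nat \<Rightarrow> real) \<Rightarrow> complex) set" where
  "trig_closure s = {u \<in> L2_space s. \<forall>\<delta>>0. \<exists>t\<in>trig_polys s. L2_sq s (u - t) < \<delta>}"

text \<open>Invariance of the closure is a condition that survives composition, so these functions
  form an algebra. Boundedness is demanded at every point, also off the space of the
  measure.\<close>

definition trig_multipliers :: "nat \<Rightarrow> ((nat \<Rightarrow> real) \<Rightarrow> complex) set" where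
  "trig_multipliers s = {\<phi> \<in> borel_measurable (torus_measure s).
     (\<exists>C. \<forall>x. norm (\<phi> x) \<le> C) \<and> (\<forall>u\<in>trig_closure s. (\<lambda>x. \<phi> x * u x) \<in> trig_closure s)}"

lemma trig_polys_subset_L2: "trig_polys s \<subseteq> L2_space s"
  unfolding trig_polys_def by (rule cfun.span_minimal) (auto intro: subspace_L2_space)

text \<open>Multiplying by a character only translates the frequencies.\<close>

lemma trig_char_mult_trig_polys:
  assumes "t \<in> trig_polys s"
  shows "(\<lambda>x. trig_char s k x * t x) \<in> trig_polys s"
  using assms unfolding trig_polys_def
proof (induction rule: cfun.span_induct_alt)
  case base
  show ?case
    using cfun.span_zero[of "range (trig_char s)"] by (simp add: zero_fun_def)
next
  case (step c b t)
  then obtain l where b: "b = trig_char s l"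
    by auto
  have "(\<lambda>x. trig_char s k x * ((\<lambda>x. c * b x) + t) x)
      = (\<lambda>x. c * trig_char s (\<lambda>j. k j + l j) x) + (\<lambda>x. trig_char s k x * t x)"
    by (auto simp: fun_eq_iff b trig_char_add algebra_simps)
  also have "\<dots> \<in> cfun.span (range (trig_char s))"
    by (intro cfun.span_add cfun.span_scale step.IH) (auto intro: cfun.span_base)
  finally show ?case .
qed

lemma trig_closure_limit:
  assumes u: "u \<in> L2_space s" and lim: "\<And>\<delta>. \<delta> > 0 \<Longrightarrow> \<exists>v\<in>trig_closure s. L2_sq s (u - v) < \<delta>"
  shows "u \<in> trig_closure s"
  unfolding trig_closure_def
proof (intro CollectI conjI u allI impI)
  fix \<delta> :: real assume "\<delta> > 0"
  then obtain v where v: "v \<in> trig_closure s" "L2_sq s (u - v) < \<delta> / 4"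
    using lim[of "\<delta> / 4"] by auto
  with \<open>\<delta> > 0\<close> obtain t where t: "t \<in> trig_polys s" "L2_sq s (v - t) < \<delta> / 4"
    by (fastforce simp: trig_closure_def dest: spec[of _ "\<delta> / 4"])
  have "v \<in> L2_space s" "t \<in> L2_space s"
    using v t trig_polys_subset_L2 by (auto simp: trig_closure_def)
  then have "L2_sq s ((u - v) + (v - t)) \<le> 2 * L2_sq s (u - v) + 2 * L2_sq s (v - t)"
    using u by (intro L2_sq_add_le) auto
  with v t show "\<exists>t\<in>trig_polys s. L2_sq s (u - t) < \<delta>"
    by (intro bexI[of _ t]) auto
qed

text \<open>Serves twice: for limits of multipliers, with the tested function as majorant, and for
  simple functions, with their limit as majorant.\<close>

lemma trig_closure_dominated_convergence:
  assumes f: "f \<in> borel_measurable (torus_measure s)" and F: "\<And>n. F n \<in> trig_closure s"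
    and g: "g \<in> L2_space s"
    and lim: "AE x in torus_measure s. (\<lambda>n. F n x) \<longlonglongrightarrow> f x"
    and le: "\<And>n. AE x in torus_measure s. norm (F n x) \<le> C * norm (g x)"
  shows "f \<in> trig_closure s"
proof -
  have F': "F n \<in> borel_measurable (torus_measure s)" for n
    using F[of n] by (auto simp: trig_closure_def L2_space_def)
  note conv = L2_dominated_convergence[OF f F' g lim le]
  show ?thesis
  proof (rule trig_closure_limit[OF conv(1)])
    fix \<delta> :: real assume "\<delta> > 0"
    then have "\<forall>\<^sub>F n in sequentially. L2_sq s (f - F n) < \<delta>"
      using conv(2) by (simp add: order_tendsto_iff)
    then show "\<exists>v\<in>trig_closure s. L2_sq s (f - v) < \<delta>"
      using F by (auto simp: eventually_sequentially)
  qed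
qed

lemma trig_polys_subset_closure: "trig_polys s \<subseteq> trig_closure s"
proof
  fix t assume t: "t \<in> trig_polys s"
  moreover have "L2_sq s (t - t) = 0"
    by (simp add: L2_sq_def)
  ultimately show "t \<in> trig_closure s"
    using trig_polys_subset_L2 unfolding trig_closure_def by (force intro!: bexI[of _ t])
qed

lemma trig_closure_add:
  assumes "u \<in> trig_closure s" "v \<in> trig_closure s"
  shows "u + v \<in> trig_closure s"
proof -
  have "\<exists>t\<in>trig_polys s. L2_sq s (u + v - t) < \<delta>" if "\<delta> > 0" for \<delta> :: real
  proof -
    have "\<delta> / 4 > 0"
      using that by simp
    then obtain t t' where t: "t \<in> trig_polys s" "L2_sq s (u - t) < \<delta> / 4"
      "t' \<in> trig_polys s" "L2_sq s (v - t') < \<delta> / 4"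
      using assms unfolding trig_closure_def by blast
    have "L2_sq s ((u - t) + (v - t')) \<le> 2 * L2_sq s (u - t) + 2 * L2_sq s (v - t')"
      using assms t trig_polys_subset_L2 by (intro L2_sq_add_le) (auto simp: trig_closure_def)
    moreover have "(u - t) + (v - t') = u + v - (t + t')"
      by simp
    ultimately show ?thesis
      using t by (intro bexI[of _ "t + t'"]) (auto simp: trig_polys_def intro: cfun.span_add)
  qed
  with assms show ?thesis
    by (auto simp: trig_closure_def)
qed

lemma trig_closure_scale:
  assumes "u \<in> trig_closure s"
  shows "(\<lambda>x. c * u x) \<in> trig_closure s"
proof (cases "c = 0")
  case True
  then show ?thesis
    using trig_polys_subset_closure cfun.span_zero[of "range (trig_char s)"]
    by (auto simp: trig_polys_def zero_fun_def)
next
  case False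
  have "\<exists>t\<in>trig_polys s. L2_sq s ((\<lambda>x. c * u x) - t) < \<delta>" if "\<delta> > 0" for \<delta> :: real
  proof -
    from that assms False have "\<exists>t\<in>trig_polys s. L2_sq s (u - t) < \<delta> / (norm c)\<^sup>2"
      by (auto simp: trig_closure_def)
    then obtain t where t: "t \<in> trig_polys s" "L2_sq s (u - t) < \<delta> / (norm c)\<^sup>2"
      by blast
    have "L2_sq s ((\<lambda>x. c * u x) - (\<lambda>x. c * t x)) = (norm c)\<^sup>2 * L2_sq s (u - t)"
      by (simp add: L2_sq_def right_diff_distrib[symmetric] norm_mult power_mult_distrib)
    also have "\<dots> < \<delta>"
      using t False by (simp add: field_simps)
    finally show ?thesis
      using t by (auto simp: trig_polys_def intro: cfun.span_scale)
  qed
  with assms show ?thesis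
    by (auto simp: trig_closure_def)
qed

section \<open>The algebra of bounded multipliers of the closure\<close>

lemma trig_multipliers_trig_char: "trig_char s k \<in> trig_multipliers s"
proof -
  have "(\<lambda>x. trig_char s k x * u x) \<in> trig_closure s" if u: "u \<in> trig_closure s" for u
  proof -
    have "\<exists>t\<in>trig_polys s. L2_sq s ((\<lambda>x. trig_char s k x * u x) - t) < \<delta>" if "\<delta> > 0" for \<delta> :: real
    proof -
      obtain t where t: "t \<in> trig_polys s" "L2_sq s (u - t) < \<delta>"
        using \<open>\<delta> > 0\<close> u by (auto simp: trig_closure_def)
      \<comment> \<open>A unimodular factor preserves the norm, so an approximant of
        \<open>u\<close> becomes an equally good approximant of the product.\<close>
      have "L2_sq s ((\<lambda>x. trig_char s k x * u x) - (\<lambda>x. trig_char s k x * t x)) = L2_sq s (u - t)"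
        by (simp add: L2_sq_def right_diff_distrib[symmetric] norm_mult)
      with t show ?thesis
        by (metis trig_char_mult_trig_polys)
    qed
    moreover have "(\<lambda>x. trig_char s k x * u x) \<in> L2_space s"
      using u by (intro L2_space_bounded_mult[where C = 1]) (auto simp: trig_closure_def)
    ultimately show ?thesis
      by (auto simp: trig_closure_def)
  qed
  then show ?thesis
    by (auto simp: trig_multipliers_def intro!: exI[of _ 1])
qed

lemma trig_multipliers_const: "(\<lambda>x. c) \<in> trig_multipliers s"
  by (auto simp: trig_multipliers_def intro: trig_closure_scale)

lemma trig_multipliers_add:
  assumes "\<phi> \<in> trig_multipliers s" "\<psi> \<in> trig_multipliers s"
  shows "(\<lambda>x. \<phi> x + \<psi> x) \<in> trig_multipliers s"
proof -
  obtain C C' where "\<And>x. norm (\<phi> x) \<le> C" "\<And>x. norm (\<psi> x) \<le> C'"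
    using assms by (auto simp: trig_multipliers_def)
  then have "norm (\<phi> x + \<psi> x) \<le> C + C'" for x
    by (meson add_mono norm_triangle_le)
  moreover have "(\<lambda>x. (\<phi> x + \<psi> x) * u x) \<in> trig_closure s" if "u \<in> trig_closure s" for u
    using assms that trig_closure_add[of "\<lambda>x. \<phi> x * u x" s "\<lambda>x. \<psi> x * u x"]
    by (auto simp: trig_multipliers_def plus_fun_def distrib_right)
  ultimately show ?thesis
    using assms by (auto simp: trig_multipliers_def intro!: exI[of _ "C + C'"])
qed

lemma trig_multipliers_mult:
  assumes "\<phi> \<in> trig_multipliers s" "\<psi> \<in> trig_multipliers s"
  shows "(\<lambda>x. \<phi> x * \<psi> x) \<in> trig_multipliers s"
proof -
  obtain C C' where "\<And>x. norm (\<phi> x) \<le> C" "\<And>x. norm (\<psi> x) \<le> C'"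
    using assms by (auto simp: trig_multipliers_def)
  then have "norm (\<phi> x * \<psi> x) \<le> C * C'" for x
    unfolding norm_mult by (meson mult_mono' norm_ge_zero)
  moreover have "(\<lambda>x. \<phi> x * \<psi> x * u x) \<in> trig_closure s" if "u \<in> trig_closure s" for u
    using assms that by (auto simp: trig_multipliers_def mult.assoc)
  ultimately show ?thesis
    using assms by (auto simp: trig_multipliers_def intro!: exI[of _ "C * C'"])
qed

text \<open>With \<open>C\<close> uniform in \<open>n\<close>, the function
  \<open>C * norm (u x)\<close> dominates every \<open>\<Phi> n x * u x\<close>. Convergence is
  asked only almost everywhere, which absorbs the exceptional face \<open>x j = pi\<close>.\<close>

lemma trig_multipliers_limit:
  assumes \<Phi>: "\<And>n. \<Phi> n \<in> trig_multipliers s" and [measurable]: "\<phi> \<in> borel_measurable (torus_measure s)"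
    and \<phi>: "\<And>x. norm (\<phi> x) \<le> C'"
    and le: "\<And>n x. x \<in> space (torus_measure s) \<Longrightarrow> norm (\<Phi> n x) \<le> C"
    and lim: "AE x in torus_measure s. (\<lambda>n. \<Phi> n x) \<longlonglongrightarrow> \<phi> x"
  shows "\<phi> \<in> trig_multipliers s"
proof -
  have "(\<lambda>x. \<phi> x * u x) \<in> trig_closure s" if u: "u \<in> trig_closure s" for u
  proof (rule trig_closure_dominated_convergence[where F = "\<lambda>n x. \<Phi> n x * u x"])
    show u': "u \<in> L2_space s"
      using u by (simp add: trig_closure_def)
    note [measurable] = L2_spaceD(1)[OF u']
    show "(\<lambda>x. \<phi> x * u x) \<in> borel_measurable (torus_measure s)"
      by measurable
    show "(\<lambda>x. \<Phi> n x * u x) \<in> trig_closure s" for n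
      using \<Phi> u by (auto simp: trig_multipliers_def)
    show "AE x in torus_measure s. (\<lambda>n. \<Phi> n x * u x) \<longlonglongrightarrow> \<phi> x * u x"
      using lim by eventually_elim (rule tendsto_mult_right)
    show "AE x in torus_measure s. norm (\<Phi> n x * u x) \<le> C * norm (u x)" for n
      using le[of _ n] by (auto intro!: AE_I2 mult_right_mono simp: norm_mult)
  qed
  then show ?thesis
    using \<phi> by (auto simp: trig_multipliers_def)
qed

section \<open>From cosines to half-spaces\<close>

lemma trig_multipliers_cos:
  assumes j: "j \<in> {1..s}"
  shows "(\<lambda>x. of_real (cos (x j - m))) \<in> trig_multipliers s"
proof -
  let ?d = "\<lambda>i. if i = j then 1 else 0 :: int"
  have char: "trig_char s ?d x = exp (\<i> * of_real (x j))" "trig_char s (\<lambda>i. - ?d i) x = exp (- \<i> * of_real (x j))" for x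
    using j by (simp_all add: trig_char_def if_distrib[of real_of_int] if_distribR sum_negf if_distrib[of "\<lambda>u. u * _"] cong: if_cong)
  have "of_real (cos (x j - m)) =
      exp (- \<i> * of_real m) / 2 * trig_char s ?d x + exp (\<i> * of_real m) / 2 * trig_char s (\<lambda>i. - ?d i) x" for x
    unfolding char cos_of_real[symmetric] cos_exp_eq
    by (simp add: exp_add[symmetric] algebra_simps add_divide_distrib)
  then show ?thesis
    by (simp only:)
      (intro trig_multipliers_add trig_multipliers_mult trig_multipliers_const trig_multipliers_trig_char)
qed

lemma trig_multipliers_polynomial:
  assumes "real_polynomial_function p" and \<psi>: "(\<lambda>x. of_real (\<psi> x)) \<in> trig_multipliers s"
  shows "(\<lambda>x. of_real (p (\<psi> x))) \<in> trig_multipliers s"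
  using assms(1)
proof induction
  case (linear f)
  then obtain c where "f = (\<lambda>x. x * c)"
    by (auto simp: real_bounded_linear)
  then show ?case
    using trig_multipliers_mult[OF \<psi> trig_multipliers_const] by simp
qed (auto intro: trig_multipliers_const trig_multipliers_add trig_multipliers_mult)

text \<open>\<open>(c + pi) / 2\<close> is the midpoint of the interval from \<open>c\<close> to
  \<open>pi\<close> and \<open>(pi - c) / 2\<close> is half its length, so a large cosine means
  being close to the midpoint. At the endpoint \<open>t = pi\<close> the two cosines are equal,
  hence its exclusion.\<close>

lemma cos_gt_iff_interval:
  fixes c t :: real
  assumes "-pi \<le> c" "c < pi" "t \<in> {-pi..pi}" "t \<noteq> pi"
  shows "cos (t - (c + pi) / 2) > cos ((pi - c) / 2) \<longleftrightarrow> t > c"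
proof
  assume "t > c"
  then have "\<bar>t - (c + pi) / 2\<bar> < (pi - c) / 2"
    using assms by (auto simp: abs_less_iff field_simps)
  then have "cos ((pi - c) / 2) < cos \<bar>t - (c + pi) / 2\<bar>"
    using assms by (intro cos_monotone_0_pi) auto
  then show "cos (t - (c + pi) / 2) > cos ((pi - c) / 2)"
    by simp
next
  assume less: "cos (t - (c + pi) / 2) > cos ((pi - c) / 2)"
  show "t > c"
  proof (rule ccontr)
    assume "\<not> t > c"
    define y where "y = (c + pi) / 2 - t"
    have y: "(pi - c) / 2 \<le> y" "y \<le> 2 * pi - (pi - c) / 2"
      using \<open>\<not> t > c\<close> assms by (auto simp: y_def field_simps)
    have cy: "cos (t - (c + pi) / 2) = cos y"
      by (metis cos_minus minus_diff_eq y_def)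
    have "cos y \<le> cos ((pi - c) / 2)"
    proof (cases "y \<le> pi")
      case True
      with y assms show ?thesis
        by (intro cos_monotone_0_pi_le) auto
    next
      case False
      \<comment> \<open>Beyond \<open>pi\<close> the cosine rises again. Reflection to
        \<open>2 * pi - y\<close> returns to the decreasing range, and \<open>t \<ge> - pi\<close>
        is what keeps the reflected point at or above \<open>(pi - c) / 2\<close>.\<close>
      have "0 \<le> (pi - c) / 2" "(pi - c) / 2 \<le> 2 * pi - y" "2 * pi - y \<le> pi"
        using \<open>c < pi\<close> y(2) False by (simp_all add: field_simps)
      have "cos y = cos (2 * pi - y)"
        by (simp add: cos_diff)
      also have "\<dots> \<le> cos ((pi - c) / 2)"
        by (intro cos_monotone_0_pi_le) fact+
      finally show ?thesis .
    qed
    with less cy show False by simp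
  qed
qed

lemma trig_multipliers_halfspace:
  assumes j: "j \<in> {1..s}"
  shows "(indicator {x. x j > c} :: _ \<Rightarrow> complex) \<in> trig_multipliers s"
proof -
  note [measurable] = measurable_component_torus[OF j]
  have range: "x j \<in> {-pi..pi}" if "x \<in> space (torus_measure s)" for x
    using that j by (auto simp: space_torus_measure PiE_iff)
  have neq: "AE x in torus_measure s. x j \<noteq> pi"
    by (rule AE_torus_component_neq[OF j])
  have meas: "(indicator {x. x j > c} :: _ \<Rightarrow> complex) \<in> borel_measurable (torus_measure s)"
  proof -
    have "(\<lambda>x. indicator {c<..} (x j) :: complex) \<in> borel_measurable (torus_measure s)"
      by measurable
    moreover have "(\<lambda>x. indicator {c<..} (x j) :: complex) = indicator {x. x j > c}"
      by (auto simp: fun_eq_iff indicator_def)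
    ultimately show ?thesis
      by simp
  qed
  consider "c < -pi" | "c \<ge> pi" | "-pi \<le> c" "c < pi"
    by linarith
  then show ?thesis
  proof cases
    case 1
    show ?thesis
    proof (rule trig_multipliers_limit[OF trig_multipliers_const[where c = 1] meas])
      show "AE x in torus_measure s. (\<lambda>n. 1) \<longlonglongrightarrow> (indicator {x. x j > c} x :: complex)"
        using AE_space by eventually_elim (use range 1 in \<open>force simp: indicator_def\<close>)
    qed (auto simp: indicator_def)
  next
    case 2
    show ?thesis
    proof (rule trig_multipliers_limit[OF trig_multipliers_const[where c = 0] meas])
      show "AE x in torus_measure s. (\<lambda>n. 0) \<longlonglongrightarrow> (indicator {x. x j > c} x :: complex)"
        using AE_space by eventually_elim (use range 2 in \<open>force simp: indicator_def\<close>)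
    qed (auto simp: indicator_def)
  next
    case 3
    define d where "d = cos ((pi - c) / 2)"
    \<comment> \<open>A ramp of slope \<open>n\<close> starting at \<open>d\<close>, clipped to the
      unit interval. Its limit is 0 at \<open>d\<close> itself, which matches the strict inequality
      of the half-space.\<close>
    define h where "h = (\<lambda>n t. min 1 (max 0 (real n * (t - d))))"
    have "continuous_on {-1..1} (h n)" for n
      unfolding h_def by (intro continuous_intros)
    \<comment> \<open>The approximation is over the range of the cosine. The error tends to 0, so
      the polynomials have the same limit as the ramps, and it is at most 1, which yields the
      uniform bound 2.\<close>
    then have "\<exists>p. real_polynomial_function p \<and> (\<forall>t\<in>{-1..1}. \<bar>h n t - p t\<bar> < 1 / real (Suc n))" for n
      by (metis Stone_Weierstrass_real_polynomial_function compact_Icc of_nat_0_less_iff zero_less_Suc zero_less_divide_1_iff)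
    then obtain p where p: "\<And>n. real_polynomial_function (p n)"
      "\<And>n t. t \<in> {-1..1} \<Longrightarrow> \<bar>h n t - p n t\<bar> < 1 / real (Suc n)"
      by metis
    have h_bounds: "0 \<le> h n t" "h n t \<le> 1" for n t
      by (auto simp: h_def)
    have h_lim: "(\<lambda>n. h n t) \<longlonglongrightarrow> (if t > d then 1 else 0)" for t
    proof (cases "t > d")
      case True
      obtain N :: nat where N: "1 / (t - d) < real N"
        using reals_Archimedean2 by blast
      have "h n t = 1" if "n \<ge> N" for n
      proof -
        have "1 / (t - d) \<le> real n"
          using N that by simp
        then have "1 \<le> real n * (t - d)"
          using True by (simp add: field_simps)
        then show ?thesis
          by (simp add: h_def)
      qed
      then have "\<forall>\<^sub>F n in sequentially. h n t = 1"
        by (auto simp: eventually_sequentially)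
      with True show ?thesis
        by (simp add: tendsto_eventually)
    next
      case False
      then have "real n * (t - d) \<le> 0" for n
        by (simp add: mult_nonneg_nonpos)
      then have "h n t = 0" for n
        by (simp add: h_def max_absorb1)
      with False show ?thesis
        by simp
    qed
    have p_lim: "(\<lambda>n. p n t) \<longlonglongrightarrow> (if t > d then 1 else 0)" if "t \<in> {-1..1}" for t
    proof -
      have "(\<lambda>n. h n t - p n t) \<longlonglongrightarrow> 0"
        by (rule Lim_null_comparison[OF _ LIMSEQ_inverse_real_of_nat])
          (use p(2)[OF that] in \<open>simp only: real_norm_def inverse_eq_divide less_imp_le eventually_True\<close>)
      from tendsto_diff[OF h_lim[of t] this] show ?thesis
        by (simp only: minus_diff_eq diff_diff_eq2 add_diff_cancel_left' diff_0_right)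
    qed
    show ?thesis
    proof (rule trig_multipliers_limit[where \<Phi> = "\<lambda>n x. of_real (p n (cos (x j - (c + pi) / 2)))"])
      show "(\<lambda>x. of_real (p n (cos (x j - (c + pi) / 2)))) \<in> trig_multipliers s" for n
        by (rule trig_multipliers_polynomial[OF p(1) trig_multipliers_cos[OF j]])
      show "norm (indicator {x. x j > c} x :: complex) \<le> 1" for x
        by (simp add: indicator_def)
      show "norm (of_real (p n (cos (x j - (c + pi) / 2))) :: complex) \<le> 2" for n x
      proof -
        have "\<bar>h n (cos (x j - (c + pi) / 2)) - p n (cos (x j - (c + pi) / 2))\<bar> < 1 / real (Suc n)"
          by (rule p) auto
        also have "\<dots> \<le> 1"
          by simp
        finally show ?thesis
          using h_bounds[of n "cos (x j - (c + pi) / 2)"] by simp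
      qed
      show "AE x in torus_measure s. (\<lambda>n. of_real (p n (cos (x j - (c + pi) / 2)))) \<longlonglongrightarrow>
          (indicator {x. x j > c} x :: complex)"
        using neq AE_space
      proof eventually_elim
        case (elim x)
        have "indicator {x. x j > c} x = (of_real (if cos (x j - (c + pi) / 2) > d then 1 else 0) :: complex)"
          using cos_gt_iff_interval[OF 3 range[OF elim(2)] elim(1)] by (simp add: d_def indicator_def)
        then show ?case
          by (simp only:) (intro tendsto_of_real p_lim, auto)
      qed
    qed (rule meas)
  qed
qed

section \<open>Indicators of measurable sets as multipliers\<close>

lemma trig_multipliers_indicator_Compl:
  assumes "(indicator A :: _ \<Rightarrow> complex) \<in> trig_multipliers s"
  shows "(indicator (- A) :: _ \<Rightarrow> complex) \<in> trig_multipliers s"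
proof -
  have "(indicator (- A) :: _ \<Rightarrow> complex) = (\<lambda>x. 1 + (- 1) * indicator A x)"
    by (auto simp: fun_eq_iff indicator_def)
  then show ?thesis
    by (simp only:) (intro trig_multipliers_add trig_multipliers_mult trig_multipliers_const assms)
qed

lemma trig_multipliers_indicator_Int:
  assumes "(indicator A :: _ \<Rightarrow> complex) \<in> trig_multipliers s" "(indicator B :: _ \<Rightarrow> complex) \<in> trig_multipliers s"
  shows "(indicator (A \<inter> B) :: _ \<Rightarrow> complex) \<in> trig_multipliers s"
  using trig_multipliers_mult[OF assms] by (simp add: indicator_inter_arith[abs_def])

lemma trig_multipliers_indicator_Un:
  assumes "(indicator A :: _ \<Rightarrow> complex) \<in> trig_multipliers s" "(indicator B :: _ \<Rightarrow> complex) \<in> trig_multipliers s"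
  shows "(indicator (A \<union> B) :: _ \<Rightarrow> complex) \<in> trig_multipliers s"
  using trig_multipliers_indicator_Compl[OF trig_multipliers_indicator_Int[OF assms[THEN trig_multipliers_indicator_Compl]]]
  by simp

lemma trig_multipliers_indicator_empty: "(indicator {} :: _ \<Rightarrow> complex) \<in> trig_multipliers s"
proof -
  have "(indicator {} :: (nat \<Rightarrow> real) \<Rightarrow> complex) = (\<lambda>x. 0)"
    by auto
  then show ?thesis
    by (simp only: trig_multipliers_const)
qed

text \<open>Finite partial unions are multipliers by induction; their indicators are bounded by 1
  and converge pointwise.\<close>

lemma trig_multipliers_indicator_UN:
  assumes A: "\<And>n::nat. (indicator (A n) :: _ \<Rightarrow> complex) \<in> trig_multipliers s"
  shows "(indicator (\<Union>n. A n) :: _ \<Rightarrow> complex) \<in> trig_multipliers s"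
proof (rule trig_multipliers_limit[where \<Phi> = "\<lambda>n. indicator (\<Union>i<n. A i)"])
  show mult: "(indicator (\<Union>i<n. A i) :: _ \<Rightarrow> complex) \<in> trig_multipliers s" for n
    by (induction n)
      (simp_all add: trig_multipliers_const lessThan_Suc trig_multipliers_indicator_Un A)
  show "AE x in torus_measure s. (\<lambda>n. indicator (\<Union>i<n. A i) x :: complex) \<longlonglongrightarrow> indicator (\<Union>n. A n) x"
    by (intro AE_I2 LIMSEQ_indicator_UN)
  have "(indicator (\<Union>i<n. A i) :: _ \<Rightarrow> complex) \<in> borel_measurable (torus_measure s)" for n
    using mult[of n] by (simp add: trig_multipliers_def)
  then show "(indicator (\<Union>n. A n) :: _ \<Rightarrow> complex) \<in> borel_measurable (torus_measure s)"
    by (rule borel_measurable_LIMSEQ_metric) (rule LIMSEQ_indicator_UN)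
  show "norm (indicator (\<Union>i<n. A i) x :: complex) \<le> 1" for n x
    by (simp add: indicator_def)
  show "norm (indicator (\<Union>n. A n) x :: complex) \<le> 1" for x
    by (simp add: indicator_def)
qed

lemma trig_multipliers_cylinder:
  assumes j: "j \<in> {1..s}" and A: "A \<in> sets borel"
  shows "(indicator {x. x j \<in> A} :: _ \<Rightarrow> complex) \<in> trig_multipliers s"
proof -
  have "A \<in> sigma_sets UNIV (range greaterThan)"
    using A by (simp add: borel_Ioi)
  then show ?thesis
  proof induction
    case (Basic a)
    then show ?case
      using trig_multipliers_halfspace[OF j] by auto
  next
    case Empty
    have "{x::nat \<Rightarrow> real. x j \<in> {}} = {}"
      by simp
    then show ?case
      by (simp only: trig_multipliers_indicator_empty)
  next
    case (Compl a)
    have "{x. x j \<in> UNIV - a} = - {x. x j \<in> a}"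
      by auto
    then show ?case
      using trig_multipliers_indicator_Compl[OF Compl.IH] by simp
  next
    case (Union a)
    have "{x. x j \<in> \<Union> (range a)} = (\<Union>n. {x. x j \<in> a n})"
      by auto
    then show ?case
      using trig_multipliers_indicator_UN[OF Union.IH] by simp
  qed
qed

text \<open>Equals the constant 1 on the whole space. It mediates between complements in the full
  function type and the complements relative to the space that generate the product
  sigma-algebra.\<close>

lemma trig_multipliers_space: "(indicator (space (torus_measure s)) :: _ \<Rightarrow> complex) \<in> trig_multipliers s"
  by (rule trig_multipliers_limit[OF trig_multipliers_const[of 1], of _ _ 1 1])
    (auto intro!: AE_I2 simp: indicator_def)

lemma trig_multipliers_indicator:
  assumes "A \<in> sets (torus_measure s)"
  shows "(indicator A :: _ \<Rightarrow> complex) \<in> trig_multipliers s"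
proof -
  let ?M = "\<lambda>j::nat. restrict_space lborel {-pi..pi::real}"
  have "A \<in> sigma_sets (space (torus_measure s))
      {{x \<in> space (torus_measure s). x i \<in> B} |i B. i \<in> {1..s} \<and> B \<in> sets (?M i)}"
    using assms by (simp add: torus_measure_def sets_PiM_single space_PiM)
  then show ?thesis
  proof induction
    case (Basic a)
    then obtain i B where i: "i \<in> {1..s}" and B: "B \<in> sets (?M i)"
      and a: "a = {x \<in> space (torus_measure s). x i \<in> B}"
      by auto
    have "B \<in> sets borel"
      using B by (simp add: sets_restrict_space_iff)
    moreover have "a = space (torus_measure s) \<inter> {x. x i \<in> B}"
      by (auto simp: a)
    ultimately show ?case
      using trig_multipliers_indicator_Int[OF trig_multipliers_space trig_multipliers_cylinder[OF i]] by simp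
  next
    case Empty
    then show ?case
      by (rule trig_multipliers_indicator_empty)
  next
    case (Compl a)
    then show ?case
      using trig_multipliers_indicator_Int[OF trig_multipliers_space trig_multipliers_indicator_Compl]
      by (simp add: Diff_eq)
  next
    case (Union a)
    then show ?case
      using trig_multipliers_indicator_UN by simp
  qed
qed

lemma trig_multipliers_sum:
  assumes "finite S" "\<And>y. y \<in> S \<Longrightarrow> \<Phi> y \<in> trig_multipliers s"
  shows "(\<lambda>x. \<Sum>y\<in>S. \<Phi> y x) \<in> trig_multipliers s"
  using assms by (induction S) (auto intro: trig_multipliers_const trig_multipliers_add)

text \<open>The constant 1 is the character of frequency 0, so applying a multiplier to it gives the
  multiplier itself.\<close>

lemma trig_multipliers_subset_closure: "trig_multipliers s \<subseteq> trig_closure s"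
proof
  fix \<phi> assume \<phi>: "\<phi> \<in> trig_multipliers s"
  have "trig_char s (\<lambda>_. 0) \<in> trig_closure s"
    by (auto simp: trig_polys_def intro!: subsetD[OF trig_polys_subset_closure] cfun.span_base)
  moreover have "trig_char s (\<lambda>_. 0) = (\<lambda>_. 1)"
    by (simp add: trig_char_def fun_eq_iff)
  ultimately show "\<phi> \<in> trig_closure s"
    using \<phi> by (fastforce simp: trig_multipliers_def)
qed

theorem trig_closure_eq_L2: "trig_closure s = L2_space s"
proof (intro equalityI subsetI)
  fix f assume f: "f \<in> L2_space s"
  note [measurable] = L2_spaceD(1)[OF f]
  obtain F where F: "\<And>i. simple_function (torus_measure s) (F i)"
    "\<And>x. x \<in> space (torus_measure s) \<Longrightarrow> (\<lambda>i. F i x) \<longlonglongrightarrow> f x"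
    "\<And>i x. x \<in> space (torus_measure s) \<Longrightarrow> dist (F i x) 0 \<le> 2 * dist (f x) 0"
    using borel_measurable_implies_sequence_metric[OF L2_spaceD(1)[OF f], of 0] by metis
  let ?V = "\<lambda>i. F i ` space (torus_measure s)"
  let ?A = "\<lambda>i y. F i -` {y} \<inter> space (torus_measure s)"
  \<comment> \<open>\<open>F i\<close> is uncontrolled off the space and could be unbounded there.
    \<open>G i\<close> agrees with it on the space and is a finite combination of indicators
    everywhere, hence a multiplier.\<close>
  define G where "G i x = (\<Sum>y\<in>?V i. y * indicator (?A i y) x)" for i x
  have G: "G i x = F i x" if "x \<in> space (torus_measure s)" for i x
  proof -
    have "G i x = (\<Sum>y\<in>?V i. if F i x = y then y else 0)"
      unfolding G_def using that by (intro sum.cong) (auto simp: indicator_def)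
    then show ?thesis
      using that simple_functionD(1)[OF F(1)] by simp
  qed
  have "G i \<in> trig_multipliers s" for i
    unfolding G_def
    by (intro trig_multipliers_sum trig_multipliers_mult trig_multipliers_const
        trig_multipliers_indicator simple_functionD[OF F(1)])
  then have "G i \<in> trig_closure s" for i
    using trig_multipliers_subset_closure by auto
  then show "f \<in> trig_closure s"
    by (rule trig_closure_dominated_convergence[where C = 2 and g = f, rotated])
      (use F f in \<open>auto intro!: AE_I2 simp: G\<close>)
qed (auto simp: trig_closure_def)

section \<open>Fourier coefficients and Parseval's identity\<close>

lemma L2_integrable_mult_cnj:
  assumes f: "f \<in> L2_space s" and g: "g \<in> L2_space s"
  shows "integrable (torus_measure s) (\<lambda>x. f x * cnj (g x))"
proof -
  note [measurable] = L2_spaceD(1)[OF f] L2_spaceD(1)[OF g]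
  have [measurable]: "(\<lambda>x. cnj (g x)) \<in> borel_measurable (torus_measure s)"
    by (rule measurable_compose[OF L2_spaceD(1)[OF g] borel_measurable_continuous_onI])
      (intro continuous_intros)
  have "integrable (torus_measure s) (\<lambda>x. (norm (f x))\<^sup>2 + (norm (g x))\<^sup>2)"
    using L2_spaceD(2)[OF f] L2_spaceD(2)[OF g] by simp
  then show ?thesis
  proof (rule Bochner_Integration.integrable_bound)
    have "norm (f x * cnj (g x)) \<le> norm ((norm (f x))\<^sup>2 + (norm (g x))\<^sup>2)" for x
    proof -
      have "norm (f x * cnj (g x)) \<le> 2 * norm (f x) * norm (g x)"
        by (simp add: norm_mult)
      also have "\<dots> \<le> (norm (f x))\<^sup>2 + (norm (g x))\<^sup>2"
        by (rule sum_squares_bound)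
      finally show ?thesis
        by simp
    qed
    then show "AE x in torus_measure s. norm (f x * cnj (g x)) \<le> norm ((norm (f x))\<^sup>2 + (norm (g x))\<^sup>2)"
      by simp
  qed measurable
qed

lemma L2_inner_add_left:
  assumes "f \<in> L2_space s" "g \<in> L2_space s" "h \<in> L2_space s"
  shows "L2_inner s (\<lambda>x. f x + g x) h = L2_inner s f h + L2_inner s g h"
  using assms by (simp add: L2_inner_def distrib_right L2_integrable_mult_cnj add_divide_distrib)

lemma L2_inner_scale_left: "L2_inner s (\<lambda>x. c * f x) h = c * L2_inner s f h"
  by (simp add: L2_inner_def mult.assoc)

lemma L2_inner_commute: "L2_inner s f g = cnj (L2_inner s g f)"
proof -
  have "(LINT x|torus_measure s. f x * cnj (g x)) = (LINT x|torus_measure s. cnj (g x * cnj (f x)))"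
    by (intro Bochner_Integration.integral_cong) (auto simp: mult.commute)
  also have "\<dots> = cnj (LINT x|torus_measure s. g x * cnj (f x))"
    by (rule Bochner_Integration.integral_cnj)
  finally show ?thesis
    by (simp add: L2_inner_def)
qed

lemma L2_norm_sq_eq_inner: "of_real ((L2_norm s f)\<^sup>2) = L2_inner s f f"
  by (simp only: L2_norm_sq L2_inner_self)

lemma L2_norm_sq_diff:
  assumes f: "f \<in> L2_space s" and g: "g \<in> L2_space s"
  shows "(L2_norm s (f - g))\<^sup>2 = (L2_norm s f)\<^sup>2 - 2 * Re (L2_inner s f g) + (L2_norm s g)\<^sup>2"
proof -
  have left: "L2_inner s (f - g) h = L2_inner s f h - L2_inner s g h" if "h \<in> L2_space s" for h
  proof -
    have "f - g = (\<lambda>x. f x + (-1) * g x)"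
      by (auto simp: fun_eq_iff)
    then show ?thesis
      using that f g L2_space_scale[OF g, of "-1"]
      by (simp only: L2_inner_add_left L2_inner_scale_left) simp
  qed
  have "L2_inner s (f - g) (f - g) = L2_inner s f f - L2_inner s f g - (L2_inner s g f - L2_inner s g g)"
  proof -
    have right: "L2_inner s h (f - g) = L2_inner s h f - L2_inner s h g" if h: "h \<in> L2_space s" for h
      by (subst L2_inner_commute, subst left[OF h]) (simp add: L2_inner_commute[of s h])
    show ?thesis
      by (simp only: left[OF L2_space_diff[OF f g]] right[OF f] right[OF g])
  qed
  also have "L2_inner s g f = cnj (L2_inner s f g)"
    by (rule L2_inner_commute)
  finally have "complex_of_real ((L2_norm s (f - g))\<^sup>2) =
      of_real ((L2_norm s f)\<^sup>2) - L2_inner s f g - (cnj (L2_inner s f g) - of_real ((L2_norm s g)\<^sup>2))"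
    by (simp only: L2_norm_sq_eq_inner)
  from arg_cong[OF this, of Re] show ?thesis
    by (simp del: of_real_power)
qed

section \<open>Finite trigonometric sums and their distance to a function\<close>

definition trig_sum ::
  "nat \<Rightarrow> (nat \<Rightarrow> int) set \<Rightarrow> ((nat \<Rightarrow> int) \<Rightarrow> complex) \<Rightarrow> (nat \<Rightarrow> real) \<Rightarrow> complex" where
  "trig_sum s F c = (\<lambda>x. \<Sum>k\<in>F. c k * trig_char s k x)"

lemma trig_sum_insert:
  assumes "finite F" "k \<notin> F"
  shows "trig_sum s (insert k F) c = (\<lambda>x. c k * trig_char s k x) + trig_sum s F c"
  using assms by (auto simp: trig_sum_def)

lemma trig_sum_in_span: "trig_sum s F c \<in> cfun.span (trig_char s ` F)"
proof (induction F rule: infinite_finite_induct)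
  case (insert k F)
  have "cfun.span (trig_char s ` F) \<subseteq> cfun.span (trig_char s ` insert k F)"
    by (rule cfun.span_mono) auto
  then show ?case
    using insert.IH unfolding trig_sum_insert[OF insert.hyps]
    by (intro cfun.span_add cfun.span_scale) (auto intro: cfun.span_base)
qed (use cfun.span_zero in \<open>auto simp: trig_sum_def zero_fun_def\<close>)

lemma trig_sum_in_L2 [simp, intro]: "trig_sum s F c \<in> L2_space s"
  by (rule set_mp[OF cfun.span_minimal[OF _ subspace_L2_space] trig_sum_in_span]) auto

lemma L2_inner_trig_sum_left:
  assumes "h \<in> L2_space s"
  shows "L2_inner s (trig_sum s F c) h = (\<Sum>k\<in>F. c k * L2_inner s (trig_char s k) h)"
proof (induction F rule: infinite_finite_induct)
  case (insert k F)
  then have "L2_inner s (trig_sum s (insert k F) c) h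
      = L2_inner s (\<lambda>x. c k * trig_char s k x + trig_sum s F c x) h"
    by (simp add: trig_sum_def)
  with insert assms show ?case
    by (simp add: L2_inner_add_left L2_inner_scale_left L2_space_scale)
qed (simp_all add: trig_sum_def L2_inner_def)

lemma L2_inner_trig_sum_right:
  assumes "h \<in> L2_space s"
  shows "L2_inner s h (trig_sum s F c) = (\<Sum>k\<in>F. cnj (c k) * fourier_coeff s h k)"
  by (subst L2_inner_commute)
    (simp add: L2_inner_trig_sum_left[OF assms] fourier_coeff_def L2_inner_commute[of s h])

lemma fourier_coeff_trig_sum:
  assumes "finite F" "F \<subseteq> int_lattice s" "k \<in> int_lattice s"
  shows "fourier_coeff s (trig_sum s F c) k = (if k \<in> F then c k else 0)"
proof -
  have "fourier_coeff s (trig_sum s F c) k = (\<Sum>l\<in>F. if l = k then c l else 0)"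
    unfolding fourier_coeff_def L2_inner_trig_sum_left[OF L2_space_trig_char]
    using assms by (intro sum.cong) (auto simp: L2_inner_trig_char)
  then show ?thesis
    using assms by simp
qed

lemma L2_norm_trig_sum:
  assumes "finite F" "F \<subseteq> int_lattice s"
  shows "(L2_norm s (trig_sum s F c))\<^sup>2 = (\<Sum>k\<in>F. (norm (c k))\<^sup>2)"
proof -
  have "complex_of_real ((L2_norm s (trig_sum s F c))\<^sup>2) = (\<Sum>k\<in>F. cnj (c k) * c k)"
    unfolding L2_norm_sq_eq_inner L2_inner_trig_sum_right[OF trig_sum_in_L2]
    by (intro sum.cong) (simp_all add: fourier_coeff_trig_sum[OF assms subsetD[OF assms(2)]])
  also have "\<dots> = of_real (\<Sum>k\<in>F. (norm (c k))\<^sup>2)"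
    by (simp add: complex_norm_square mult.commute del: of_real_power)
  finally show ?thesis
    by (simp only: of_real_eq_iff)
qed

text \<open>Completing the square in each coefficient. The choice of the Fourier coefficients for
  \<open>c\<close> gives Bessel's inequality, and for any other \<open>c\<close> the last sum is the
  penalty paid.\<close>

lemma L2_norm_diff_trig_sum:
  assumes f: "f \<in> L2_space s" and F: "finite F" "F \<subseteq> int_lattice s"
  shows "(L2_norm s (f - trig_sum s F c))\<^sup>2 =
    (L2_norm s f)\<^sup>2 - (\<Sum>k\<in>F. (norm (fourier_coeff s f k))\<^sup>2)
      + (\<Sum>k\<in>F. (norm (fourier_coeff s f k - c k))\<^sup>2)"
proof -
  have *: "(norm (z - w))\<^sup>2 = (norm z)\<^sup>2 - 2 * Re (cnj w * z) + (norm w)\<^sup>2" for z w :: complex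
    unfolding cmod_power2 by (simp add: power2_eq_square algebra_simps)
  show ?thesis
    unfolding L2_norm_sq_diff[OF f trig_sum_in_L2] L2_norm_trig_sum[OF F] L2_inner_trig_sum_right[OF f] *
    by (simp add: sum.distrib sum_subtractf sum_distrib_left)
qed

lemma bessel_inequality:
  assumes "f \<in> L2_space s" "finite F" "F \<subseteq> int_lattice s"
  shows "(\<Sum>k\<in>F. (norm (fourier_coeff s f k))\<^sup>2) \<le> (L2_norm s f)\<^sup>2"
  using L2_norm_diff_trig_sum[OF assms, of "fourier_coeff s f"]
    zero_le_power2[of "L2_norm s (f - trig_sum s F (fourier_coeff s f))"] by simp

lemma trig_polys_imp_trig_sum:
  assumes "t \<in> trig_polys s"
  shows "\<exists>F c. finite F \<and> F \<subseteq> int_lattice s \<and> t = trig_sum s F c"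
  using assms unfolding trig_polys_def
proof (induction rule: cfun.span_induct_alt)
  case base
  show ?case
    by (intro exI[of _ "{}"]) (auto simp: trig_sum_def)
next
  case (step c b t)
  obtain F d where F: "finite F" "F \<subseteq> int_lattice s" and t: "t = trig_sum s F d"
    using step.IH by blast
  obtain k where b: "b = trig_char s k" and k: "k \<in> int_lattice s"
    using step.hyps by (metis imageE trig_char_restrict restrict_int_lattice)
  \<comment> \<open>The frequency \<open>k\<close> may already occur in \<open>F\<close>, so its
    coefficient is added to the old one instead of replacing it.\<close>
  have "(\<lambda>x. c * b x) + t =
      trig_sum s (insert k F) (\<lambda>l. (if l \<in> F then d l else 0) + (if l = k then c else 0))" (is "?l = ?r")
  proof
    fix x
    have "?r x = (\<Sum>l\<in>insert k F. (if l \<in> F then d l * trig_char s l x else 0)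
        + (if l = k then c * trig_char s l x else 0))"
      unfolding trig_sum_def by (intro sum.cong) (auto simp: distrib_right)
    also have "\<dots> = (\<Sum>l\<in>insert k F. if l \<in> F then d l * trig_char s l x else 0) + c * b x"
      using F by (simp add: sum.distrib b)
    also have "(\<Sum>l\<in>insert k F. if l \<in> F then d l * trig_char s l x else 0) = t x"
      unfolding t trig_sum_def using F by (intro sum.mono_neutral_cong_right) auto
    finally show "?l x = ?r x"
      by simp
  qed
  then show ?case
    using F k by (intro exI[of _ "insert k F"]) blast
qed

text \<open>The converse of Bessel's inequality up to \<open>\<delta>\<close>: density provides a
  close trigonometric sum, and exchanging its coefficients for the Fourier coefficients can only
  reduce the distance.\<close>

lemma parseval_approx:
  assumes f: "f \<in> L2_space s" and "\<delta> > 0"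
  obtains F where "finite F" "F \<subseteq> int_lattice s"
    "(L2_norm s f)\<^sup>2 < (\<Sum>k\<in>F. (norm (fourier_coeff s f k))\<^sup>2) + \<delta>"
proof -
  have pos: "\<delta> * (2 * pi) ^ s > 0"
    using \<open>\<delta> > 0\<close> by simp
  have "f \<in> trig_closure s"
    using f by (simp only: trig_closure_eq_L2)
  with pos obtain t where t: "t \<in> trig_polys s" and less: "L2_sq s (f - t) < \<delta> * (2 * pi) ^ s"
    unfolding trig_closure_def by blast
  from less have "(L2_norm s (f - t))\<^sup>2 < \<delta>"
    by (simp add: L2_norm_sq divide_less_eq del: fun_diff_def)
  moreover obtain F c where F: "finite F" "F \<subseteq> int_lattice s" and "t = trig_sum s F c"
    using trig_polys_imp_trig_sum[OF t] by blast
  ultimately have "(L2_norm s f)\<^sup>2 - (\<Sum>k\<in>F. (norm (fourier_coeff s f k))\<^sup>2)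
      + (\<Sum>k\<in>F. (norm (fourier_coeff s f k - c k))\<^sup>2) < \<delta>"
    using L2_norm_diff_trig_sum[OF f F] by simp
  moreover have "(\<Sum>k\<in>F. (norm (fourier_coeff s f k - c k))\<^sup>2) \<ge> 0"
    by (intro sum_nonneg) simp
  ultimately show ?thesis
    using F that by force
qed

text \<open>Makes the definite description in \<open>korobov_norm\<close> meaningful: all admissible
  \<open>g\<close> for the same \<open>f\<close> share their coefficients. Each inequality combines
  \<open>parseval_approx\<close> for one function with Bessel for the other.\<close>

lemma L2_norm_cong_fourier_coeff:
  assumes "f \<in> L2_space s" "g \<in> L2_space s"
    and "\<And>k. k \<in> int_lattice s \<Longrightarrow> fourier_coeff s f k = fourier_coeff s g k"
  shows "L2_norm s f = L2_norm s g"
proof -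
  have "(L2_norm s f)\<^sup>2 \<le> (L2_norm s g)\<^sup>2"
    if f: "f \<in> L2_space s" and g: "g \<in> L2_space s"
      and eq: "\<And>k. k \<in> int_lattice s \<Longrightarrow> fourier_coeff s f k = fourier_coeff s g k" for f g
  proof (rule field_le_epsilon)
    fix \<delta> :: real assume "\<delta> > 0"
    with f obtain F where F: "finite F" "F \<subseteq> int_lattice s"
      "(L2_norm s f)\<^sup>2 < (\<Sum>k\<in>F. (norm (fourier_coeff s f k))\<^sup>2) + \<delta>"
      using parseval_approx by blast
    have "(\<Sum>k\<in>F. (norm (fourier_coeff s f k))\<^sup>2) = (\<Sum>k\<in>F. (norm (fourier_coeff s g k))\<^sup>2)"
      using F eq by (intro sum.cong) auto
    with F bessel_inequality[OF g F(1,2)] show "(L2_norm s f)\<^sup>2 \<le> (L2_norm s g)\<^sup>2 + \<delta>"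
      by simp
  qed
  from this[of f g] this[of g f] assms show ?thesis
    by (metis L2_norm_nonneg order_antisym power2_eq_iff_nonneg)
qed

section \<open>The approximation numbers of the Korobov ball\<close>

lemma korobov_weight_pos: "a > 0 \<Longrightarrow> korobov_weight s a k > 0"
  unfolding korobov_weight_def by (intro prod_pos) (simp add: add_pos_nonneg)

lemma korobov_norm_eq:
  assumes "a > 0" and g: "g \<in> L2_space s" "is_korobov_conv s r a f g"
  shows "korobov_norm s r a f = L2_norm s g"
  unfolding korobov_norm_def
proof (rule the_equality)
  show "\<exists>h\<in>L2_space s. is_korobov_conv s r a f h \<and> L2_norm s g = L2_norm s h"
    using g by blast
next
  fix c assume "\<exists>h\<in>L2_space s. is_korobov_conv s r a f h \<and> c = L2_norm s h"
  then obtain h where h: "h \<in> L2_space s" "is_korobov_conv s r a f h" "c = L2_norm s h"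
    by blast
  have "fourier_coeff s h k = fourier_coeff s g k" if "k \<in> int_lattice s" for k
    using g(2) h(2) that korobov_weight_pos[OF \<open>a > 0\<close>, of s k] by (auto simp: is_korobov_conv_def)
  with g h show "c = L2_norm s g"
    using L2_norm_cong_fourier_coeff by blast
qed

text \<open>Replaces the definite description by an existential statement, the only form in which
  the ball is used afterwards.\<close>

lemma korobov_ball_iff:
  assumes "a > 0"
  shows "f \<in> korobov_ball s r a \<longleftrightarrow>
    f \<in> L2_space s \<and> (\<exists>g\<in>L2_space s. is_korobov_conv s r a f g \<and> L2_norm s g \<le> 1)"
  using korobov_norm_eq[OF assms] by (auto simp: korobov_ball_def korobov_space_def)

text \<open>The inequality is strict: a frequency with singular value exactly
  \<open>\<epsilon>\<close> may be dropped within the allowed error, while combinations of the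
  retained ones can exceed \<open>\<epsilon>\<close> strictly.\<close>

definition korobov_index_set :: "real \<Rightarrow> real \<Rightarrow> nat \<Rightarrow> real \<Rightarrow> (nat \<Rightarrow> int) set" where
  "korobov_index_set r a s \<epsilon> = {k \<in> int_lattice s. korobov_weight s a k powr (- r) > \<epsilon>}"

lemma korobov_ball_truncation:
  assumes "a > 0" "\<epsilon> > 0" and fin: "finite (korobov_index_set r a s \<epsilon>)" and f: "f \<in> korobov_ball s r a"
  shows "L2_norm s (f - trig_sum s (korobov_index_set r a s \<epsilon>) (fourier_coeff s f)) \<le> \<epsilon>"
proof -
  let ?A = "korobov_index_set r a s \<epsilon>"
  have A: "?A \<subseteq> int_lattice s"
    by (auto simp: korobov_index_set_def)
  obtain g where f2: "f \<in> L2_space s" and g: "g \<in> L2_space s" "is_korobov_conv s r a f g" "L2_norm s g \<le> 1"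
    using f korobov_ball_iff[OF \<open>a > 0\<close>] by blast
  have "(L2_norm s (f - trig_sum s ?A (fourier_coeff s f)))\<^sup>2 \<le> \<epsilon>\<^sup>2"
  proof (rule field_le_epsilon)
    fix \<delta> :: real assume "\<delta> > 0"
    obtain F where F: "finite F" "F \<subseteq> int_lattice s"
      "(L2_norm s f)\<^sup>2 < (\<Sum>k\<in>F. (norm (fourier_coeff s f k))\<^sup>2) + \<delta>"
      using parseval_approx[OF f2 \<open>\<delta> > 0\<close>] by blast
    \<comment> \<open>Outside the index set the multiplier is at most \<open>\<epsilon>\<close>, so
      the tail of \<open>f\<close> is controlled by that of \<open>g\<close>, which Bessel bounds by
      1.\<close>
    have "(norm (fourier_coeff s f k))\<^sup>2 \<le> \<epsilon>\<^sup>2 * (norm (fourier_coeff s g k))\<^sup>2" if "k \<in> F - ?A" for k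
    proof -
      have "norm (fourier_coeff s f k) = korobov_weight s a k powr (- r) * norm (fourier_coeff s g k)"
        using that F(2) g(2) by (auto simp: is_korobov_conv_def norm_mult)
      also have "\<dots> \<le> \<epsilon> * norm (fourier_coeff s g k)"
        using that F(2) by (intro mult_right_mono) (auto simp: korobov_index_set_def)
      finally show ?thesis
        unfolding power_mult_distrib[symmetric] by (rule power_mono) simp
    qed
    then have "(\<Sum>k\<in>F-?A. (norm (fourier_coeff s f k))\<^sup>2) \<le> \<epsilon>\<^sup>2 * (\<Sum>k\<in>F-?A. (norm (fourier_coeff s g k))\<^sup>2)"
      unfolding sum_distrib_left by (rule sum_mono)
    also have "\<dots> \<le> \<epsilon>\<^sup>2 * (L2_norm s g)\<^sup>2"
      using F by (intro mult_left_mono bessel_inequality g) auto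
    also have "\<dots> \<le> \<epsilon>\<^sup>2"
      using g(3) by (simp add: mult_left_le power_le_one)
    finally have tail: "(\<Sum>k\<in>F-?A. (norm (fourier_coeff s f k))\<^sup>2) \<le> \<epsilon>\<^sup>2" .
    \<comment> \<open>\<open>F\<close> need not contain the index set, so the sum is enlarged to
      their union before splitting.\<close>
    have "(\<Sum>k\<in>F. (norm (fourier_coeff s f k))\<^sup>2) \<le> (\<Sum>k\<in>?A \<union> (F - ?A). (norm (fourier_coeff s f k))\<^sup>2)"
      using F fin by (intro sum_mono2) auto
    also have "\<dots> = (\<Sum>k\<in>?A. (norm (fourier_coeff s f k))\<^sup>2) + (\<Sum>k\<in>F-?A. (norm (fourier_coeff s f k))\<^sup>2)"
      using F fin by (intro sum.union_disjoint) auto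
    finally show "(L2_norm s (f - trig_sum s ?A (fourier_coeff s f)))\<^sup>2 \<le> \<epsilon>\<^sup>2 + \<delta>"
      unfolding L2_norm_diff_trig_sum[OF f2 fin A] using F(3) tail by simp
  qed
  with \<open>\<epsilon> > 0\<close> show ?thesis
    by (simp add: power2_le_iff_abs_le)
qed

lemma n_eps_korobov_le_card:
  assumes "a > 0" "\<epsilon> > 0" and fin: "finite (korobov_index_set r a s \<epsilon>)"
  shows "n_eps_korobov r a s \<epsilon> \<le> enat (card (korobov_index_set r a s \<epsilon>))"
  unfolding n_eps_korobov_def n_eps_def
proof (intro Inf_lower CollectI exI conjI)
  let ?A = "korobov_index_set r a s \<epsilon>"
  let ?L = "cfun.span (trig_char s ` ?A)"
  show "?L \<subseteq> L2_space s"
    by (rule cfun.span_minimal[OF _ subspace_L2_space]) auto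
  show "finite (trig_char s ` ?A)" "card (trig_char s ` ?A) \<le> card ?A"
    using fin by (auto intro: card_image_le)
  show "(SUP f\<in>korobov_ball s r a. INF g\<in>?L. ereal (L2_norm s (f - g))) \<le> ereal \<epsilon>"
  proof (rule SUP_least)
    fix f assume "f \<in> korobov_ball s r a"
    then show "(INF g\<in>?L. ereal (L2_norm s (f - g))) \<le> ereal \<epsilon>"
      using korobov_ball_truncation[OF assms]
      by (intro INF_lower2[OF trig_sum_in_span[of s ?A "fourier_coeff s f"]]) (simp del: fun_diff_def)
  qed
qed simp_all

text \<open>Gaussian elimination, by induction on the equations: a nonzero entry
  \<open>M l b\<close> is the pivot that removes the unknown \<open>l\<close> together with the
  equation \<open>b\<close>.\<close>

lemma underdetermined_system_nontrivial:
  fixes M :: "'k \<Rightarrow> 'b \<Rightarrow> 'c :: field"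
  assumes "finite B" "finite A" "card B < card A"
  shows "\<exists>c. (\<exists>k\<in>A. c k \<noteq> 0) \<and> (\<forall>b\<in>B. (\<Sum>k\<in>A. c k * M k b) = 0)"
  using assms
proof (induction B arbitrary: A M rule: finite_induct)
  case empty
  then obtain k where "k \<in> A"
    by fastforce
  then show ?case
    by (intro exI[of _ "\<lambda>_. 1"]) auto
next
  case (insert b B)
  show ?case
  proof (cases "\<forall>k\<in>A. M k b = 0")
    case True
    obtain c where "\<exists>k\<in>A. c k \<noteq> 0" "\<forall>x\<in>B. (\<Sum>k\<in>A. c k * M k x) = 0"
      using insert.IH[of A M] insert.prems insert.hyps by auto
    with True show ?thesis
      by (intro exI[of _ c]) auto
  next
    case False
    then obtain l where l: "l \<in> A" "M l b \<noteq> 0"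
      by blast
    have "card B < card (A - {l})"
      using insert.prems insert.hyps l by simp
    then obtain c where c: "\<exists>k\<in>A-{l}. c k \<noteq> 0"
      "\<forall>x\<in>B. (\<Sum>k\<in>A-{l}. c k * (M k x - M k b / M l b * M l x)) = 0"
      using insert.IH[of "A - {l}" "\<lambda>k x. M k x - M k b / M l b * M l x"] insert.prems by auto
    \<comment> \<open>The unknown \<open>l\<close> is solved from equation \<open>b\<close>;
      substituting it into any other equation gives exactly the eliminated one.\<close>
    define d where "d = c(l := - (\<Sum>k\<in>A-{l}. c k * (M k b / M l b)))"
    have d: "(\<Sum>k\<in>A. d k * M k x) = (\<Sum>k\<in>A-{l}. c k * (M k x - M k b / M l b * M l x))" for x
    proof -
      have "(\<Sum>k\<in>A. d k * M k x) = d l * M l x + (\<Sum>k\<in>A-{l}. d k * M k x)"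
        using l insert.prems by (intro sum.remove) auto
      also have "(\<Sum>k\<in>A-{l}. d k * M k x) = (\<Sum>k\<in>A-{l}. c k * M k x)"
        by (intro sum.cong) (auto simp: d_def)
      also have "d l * M l x = - (\<Sum>k\<in>A-{l}. c k * (M k b / M l b) * M l x)"
        by (simp add: d_def sum_distrib_right)
      finally show ?thesis
        by (simp add: sum_subtractf algebra_simps)
    qed
    have "\<exists>k\<in>A. d k \<noteq> 0"
      using c(1) by (auto simp: d_def)
    moreover have "(\<Sum>k\<in>A. d k * M k b) = 0"
      unfolding d using l by simp
    ultimately show ?thesis
      using c(2) by (intro exI[of _ d]) (auto simp: d)
  qed
qed

text \<open>The version for finite subsets also serves \<open>a < 1\<close>, where finiteness of the
  index set is not established. With more characters than spanning vectors, some nonzero combination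
  is orthogonal to all of them.\<close>

lemma card_le_n_eps_korobov:
  assumes "a > 0" "\<epsilon> > 0" and A: "A \<subseteq> korobov_index_set r a s \<epsilon>" "finite A"
  shows "enat (card A) \<le> n_eps_korobov r a s \<epsilon>"
  unfolding n_eps_korobov_def n_eps_def
proof (intro Inf_greatest, elim CollectE exE conjE)
  fix m n L B
  assume m: "m = enat n" and L: "L \<subseteq> L2_space s" "L = cfun.span B" and B: "finite B" "card B \<le> n"
    and le: "(SUP f\<in>korobov_ball s r a. INF g\<in>L. ereal (L2_norm s (f - g))) \<le> ereal \<epsilon>"
  show "enat (card A) \<le> m"
  proof (rule ccontr)
    assume "\<not> enat (card A) \<le> m"
    then have "card B < card A"
      using m B by simp
    then obtain c where c: "\<exists>k\<in>A. c k \<noteq> 0" "\<And>b. b \<in> B \<Longrightarrow> (\<Sum>k\<in>A. c k * L2_inner s (trig_char s k) b) = 0"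
      using underdetermined_system_nontrivial[OF B(1) A(2), of "\<lambda>k b. L2_inner s (trig_char s k) b"] by blast
    have AZ: "A \<subseteq> int_lattice s"
      using A by (auto simp: korobov_index_set_def)
    let ?w = "\<lambda>k. korobov_weight s a k powr r"
    have w: "?w k > 0" for k
      using korobov_weight_pos[OF \<open>a > 0\<close>, of s k] by simp
    \<comment> \<open>The squared norm of the preimage before scaling. Division by its root places
      \<open>f\<close> on the unit sphere of the Korobov space.\<close>
    define R where "R = (\<Sum>k\<in>A. (norm (of_real (?w k) * c k))\<^sup>2)"
    have "R > 0"
    proof -
      obtain k where "k \<in> A" "c k \<noteq> 0"
        using c(1) by blast
      then show ?thesis
        unfolding R_def using A(2) w[of k] by (intro sum_pos2[of A k]) auto
    qed
    define d where "d k = c k / of_real (sqrt R)" for k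
    define f where "f = trig_sum s A d"
    define g where "g = trig_sum s A (\<lambda>k. of_real (?w k) * d k)"
    have "(L2_norm s g)\<^sup>2 = (\<Sum>k\<in>A. (norm (of_real (?w k) * c k))\<^sup>2 / R)"
      unfolding g_def L2_norm_trig_sum[OF A(2) AZ] using \<open>R > 0\<close>
      by (intro sum.cong) (auto simp: d_def norm_divide norm_mult power_divide power_mult_distrib)
    also have "\<dots> = 1"
      using \<open>R > 0\<close> by (simp add: sum_divide_distrib[symmetric] R_def)
    finally have norm_g: "(\<Sum>k\<in>A. (norm (of_real (?w k) * d k))\<^sup>2) = 1" "L2_norm s g = 1"
      using L2_norm_nonneg[of s g] L2_norm_trig_sum[OF A(2) AZ, of "\<lambda>k. of_real (?w k) * d k"]
      by (simp_all add: power2_eq_1_iff g_def[symmetric])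
    have "is_korobov_conv s r a f g"
      using korobov_weight_pos[OF \<open>a > 0\<close>, of s]
      by (auto simp: is_korobov_conv_def f_def g_def fourier_coeff_trig_sum[OF A(2) AZ]
          powr_minus less_imp_neq[symmetric])
    then have f_ball: "f \<in> korobov_ball s r a"
      using norm_g by (auto simp: korobov_ball_iff[OF \<open>a > 0\<close>] f_def g_def)
    have less: "\<epsilon> * ?w k < 1" if "k \<in> A" for k
      using that A w[of k] by (auto simp: korobov_index_set_def powr_minus field_simps)
    obtain l where l: "l \<in> A" "d l \<noteq> 0"
      using c(1) \<open>R > 0\<close> by (auto simp: d_def)
    \<comment> \<open>Every term satisfies the weak inequality because
      \<open>\<epsilon> * ?w k < 1\<close> on \<open>A\<close>; a nonzero coefficient makes one of
      them strict.\<close>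
    have "(\<Sum>k\<in>A. \<epsilon>\<^sup>2 * (norm (of_real (?w k) * d k))\<^sup>2) < (\<Sum>k\<in>A. (norm (d k))\<^sup>2)"
    proof (rule sum_strict_mono_ex1[OF A(2)])
      have eq: "\<epsilon>\<^sup>2 * (norm (of_real (?w k) * d k))\<^sup>2 = (\<epsilon> * ?w k)\<^sup>2 * (norm (d k))\<^sup>2" for k
        by (simp add: norm_mult power_mult_distrib)
      show "\<forall>k\<in>A. \<epsilon>\<^sup>2 * (norm (of_real (?w k) * d k))\<^sup>2 \<le> (norm (d k))\<^sup>2"
        unfolding eq using less w \<open>\<epsilon> > 0\<close>
        by (auto intro!: mult_left_le_one_le power_le_one simp: less_imp_le)
      have "(\<epsilon> * ?w l)\<^sup>2 < 1"
        using less[OF l(1)] w[of l] \<open>\<epsilon> > 0\<close> by (simp add: abs_square_less_1)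
      then show "\<exists>k\<in>A. \<epsilon>\<^sup>2 * (norm (of_real (?w k) * d k))\<^sup>2 < (norm (d k))\<^sup>2"
        unfolding eq using l by (intro bexI[of _ l]) auto
    qed
    then have "\<epsilon>\<^sup>2 < (L2_norm s f)\<^sup>2"
      unfolding f_def L2_norm_trig_sum[OF A(2) AZ] sum_distrib_left[symmetric] norm_g by simp
    then have norm_f: "\<epsilon> < L2_norm s f"
      using power_less_imp_less_base L2_norm_nonneg by blast
    have orth: "L2_inner s h f = 0 \<and> h \<in> L2_space s" if "h \<in> L" for h
      using that unfolding L(2)
    proof (induction rule: cfun.span_induct_alt)
      case base
      then show ?case
        using cfun.subspace_0[OF subspace_L2_space] by (simp add: L2_inner_def zero_fun_def)
    next
      case (step e b h)
      have b: "b \<in> L2_space s"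
        using step.hyps L cfun.span_base by blast
      have "L2_inner s f b = (\<Sum>k\<in>A. c k * L2_inner s (trig_char s k) b) / of_real (sqrt R)"
        unfolding f_def L2_inner_trig_sum_left[OF b] by (simp add: d_def sum_divide_distrib)
      then have "L2_inner s b f = 0"
        using c(2)[OF step.hyps] by (simp add: L2_inner_commute[of s b])
      with step.IH b show ?case
        by (auto simp: plus_fun_def L2_inner_add_left L2_inner_scale_left L2_space_scale f_def
            intro: L2_space_add[unfolded plus_fun_def])
    qed
    \<comment> \<open>By Pythagoras no element of a subspace orthogonal to \<open>f\<close> is
      closer to \<open>f\<close> than 0 is.\<close>
    have "ereal (L2_norm s f) \<le> (INF g\<in>L. ereal (L2_norm s (f - g)))"
    proof (rule INF_greatest)
      fix h assume h: "h \<in> L"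
      have "L2_inner s f h = 0"
        using orth[OF h] by (simp add: L2_inner_commute[of s f])
      then have "(L2_norm s f)\<^sup>2 \<le> (L2_norm s (f - h))\<^sup>2"
        using L2_norm_sq_diff[of f s h] orth[OF h] by (simp add: f_def del: fun_diff_def)
      then show "ereal (L2_norm s f) \<le> ereal (L2_norm s (f - h))"
        using L2_norm_nonneg power2_le_imp_le by (simp del: fun_diff_def)
    qed
    also have "\<dots> \<le> ereal \<epsilon>"
      by (rule order_trans[OF SUP_upper[OF f_ball] le])
    finally show False
      using norm_f by simp
  qed
qed

section \<open>Counting frequencies\<close>

text \<open>Bernoulli's inequality for a negative exponent, from \<open>ln (1 - u) \<le> - u\<close>
  and 1 + x \<le> exp x. It is used with u = 1/x for telescoping and with u = 2/(a q) to reach the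
  base a - 2/q.\<close>

lemma one_minus_powr_neg_ge:
  fixes u q :: real
  assumes "u < 1" "q \<ge> 0"
  shows "1 + q * u \<le> (1 - u) powr (- q)"
proof -
  have "q * u \<le> - q * ln (1 - u)"
    using ln_le_minus_one[of "1 - u"] mult_left_mono[of "ln (1 - u)" "- u" q] assms by simp
  then have "1 + q * u \<le> exp (- q * ln (1 - u))"
    using exp_ge_add_one_self[of "- q * ln (1 - u)"] by linarith
  then show ?thesis
    using assms by (simp add: powr_def)
qed

lemma powr_minus_one_add:
  fixes x q :: real
  assumes "x > 0"
  shows "x powr (- (1 + q)) = x powr (- q) / x"
proof -
  have "- (1 + q) = - q - 1"
    by simp
  with assms show ?thesis
    by (simp only: powr_diff powr_one)
qed

text \<open>The right-hand side is the integral of q t^(-(1 + q)) over [x - 1, x], and the integrand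
  is smallest at x. Bernoulli's inequality replaces the integration.\<close>

lemma powr_neg_telescope:
  fixes x q :: real
  assumes "x > 1" "q > 0"
  shows "q * x powr (- (1 + q)) \<le> (x - 1) powr (- q) - x powr (- q)"
proof -
  have "x powr (- q) * (1 + q * (1 / x)) \<le> x powr (- q) * (1 - 1 / x) powr (- q)"
    using assms by (intro mult_left_mono one_minus_powr_neg_ge) auto
  also have "\<dots> = (x - 1) powr (- q)"
    using assms by (simp add: powr_mult[symmetric] algebra_simps)
  finally have "x powr (- q) + q * (x powr (- q) / x) \<le> (x - 1) powr (- q)"
    by (simp add: algebra_simps)
  then show ?thesis
    using powr_minus_one_add[of x q] assms by simp
qed

lemma sum_powr_le:
  fixes a q :: real
  assumes "a > 0" "q > 0"
  shows "(\<Sum>i<N. (a + real (Suc i)) powr (- (1 + q))) \<le> a powr (- q) / q"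
proof -
  have "q * (\<Sum>i<N. (a + real (Suc i)) powr (- (1 + q)))
      \<le> (\<Sum>i<N. (a + real i) powr (- q) - (a + real (Suc i)) powr (- q))"
    unfolding sum_distrib_left
  proof (rule sum_mono)
    fix i
    show "q * (a + real (Suc i)) powr (- (1 + q)) \<le> (a + real i) powr (- q) - (a + real (Suc i)) powr (- q)"
      using powr_neg_telescope[of "a + real (Suc i)" q] assms by (simp add: add_ac)
  qed
  also have "\<dots> = a powr (- q) - (a + real N) powr (- q)"
    by (subst sum_lessThan_telescope') simp
  also have "\<dots> \<le> a powr (- q)"
    by simp
  finally have "q * (\<Sum>i<N. (a + real (Suc i)) powr (- (1 + q))) \<le> a powr (- q)" .
  then show ?thesis
    using assms by (simp add: field_simps)
qed

lemma sum_symmetric_interval: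
  fixes f :: "nat \<Rightarrow> real"
  shows "(\<Sum>k\<in>{- int N..int N}. f (nat \<bar>k\<bar>)) = f 0 + 2 * (\<Sum>i<N. f (Suc i))"
proof (induction N)
  case (Suc N)
  have "{- int (Suc N)..int (Suc N)} = insert (- int (Suc N)) (insert (int (Suc N)) {- int N..int N})"
    by auto
  with Suc show ?case
    by (simp add: nat_add_distrib)
qed simp

text \<open>The summand \<open>1 / a\<close> comes from frequency 0 and \<open>2 / q\<close> from
  the two tails.\<close>

lemma sum_int_powr_le:
  fixes a q :: real
  assumes "a > 0" "q > 0"
  shows "(\<Sum>k\<in>{- int N..int N}. (a + real_of_int \<bar>k\<bar>) powr (- (1 + q))) \<le> a powr (- q) * (1 / a + 2 / q)"
proof -
  have "(\<Sum>k\<in>{- int N..int N}. (a + real_of_int \<bar>k\<bar>) powr (- (1 + q)))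
      = a powr (- (1 + q)) + 2 * (\<Sum>i<N. (a + real (Suc i)) powr (- (1 + q)))"
    using sum_symmetric_interval[of "\<lambda>n. (a + real n) powr (- (1 + q))" N] by simp
  also have "\<dots> \<le> a powr (- (1 + q)) + 2 * (a powr (- q) / q)"
    using sum_powr_le[OF assms, of N] by simp
  also have "a powr (- (1 + q)) = a powr (- q) / a"
    using assms by (intro powr_minus_one_add)
  finally show ?thesis
    by (simp add: algebra_simps)
qed

section \<open>Size of the set of relevant frequencies\<close>

lemma korobov_index_set_iff:
  assumes "r > 0" "a > 0" "\<epsilon> > 0"
  shows "k \<in> korobov_index_set r a s \<epsilon> \<longleftrightarrow> k \<in> int_lattice s \<and> korobov_weight s a k < \<epsilon> powr (- 1 / r)"
proof -
  have pos: "korobov_weight s a k > 0"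
    by (rule korobov_weight_pos[OF \<open>a > 0\<close>])
  have "\<epsilon> < korobov_weight s a k powr (- r) \<longleftrightarrow>
      (korobov_weight s a k powr (- r)) powr (- 1 / r) < \<epsilon> powr (- 1 / r)" (is "_ < ?W \<longleftrightarrow> _")
  proof
    assume "\<epsilon> < ?W"
    then show "?W powr (- 1 / r) < \<epsilon> powr (- 1 / r)"
      using assms by (intro powr_less_mono2_neg) auto
  next
    assume less: "?W powr (- 1 / r) < \<epsilon> powr (- 1 / r)"
    show "\<epsilon> < ?W"
    proof (rule ccontr)
      assume "\<not> \<epsilon> < ?W"
      then have "\<epsilon> powr (- 1 / r) \<le> ?W powr (- 1 / r)"
        using assms pos by (intro powr_mono2') auto
      with less show False
        by simp
    qed
  qed
  also have "(korobov_weight s a k powr (- r)) powr (- 1 / r) = korobov_weight s a k"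
    using assms pos by (simp add: powr_powr)
  finally show ?thesis
    by (auto simp: korobov_index_set_def)
qed

text \<open>For \<open>a \<ge> 1\<close> all factors of the weight are at least 1, so each single
  factor is bounded by the product. A box is wanted because sums of products factorize over
  it.\<close>

lemma korobov_index_set_subset_box:
  assumes "r > 0" "a \<ge> 1" "\<epsilon> > 0"
  obtains N :: nat where "korobov_index_set r a s \<epsilon> \<subseteq> (\<Pi>\<^sub>E j\<in>{1..s}. {- int N..int N})"
proof -
  obtain N :: nat where N: "\<epsilon> powr (- 1 / r) \<le> real N"
    using real_arch_simple by blast
  have "k \<in> (\<Pi>\<^sub>E j\<in>{1..s}. {- int N..int N})" if k: "k \<in> korobov_index_set r a s \<epsilon>" for k
  proof -
    have "a > 0"
      using assms by simp
    then have k': "k \<in> int_lattice s" "korobov_weight s a k < \<epsilon> powr (- 1 / r)"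
      using k korobov_index_set_iff[of r a \<epsilon> k s] assms by auto
    have "\<bar>k j\<bar> \<le> int N" if j: "j \<in> {1..s}" for j
    proof -
      have "a + real_of_int \<bar>k j\<bar> \<le> (a + real_of_int \<bar>k j\<bar>) * (\<Prod>i\<in>{1..s}-{j}. (a + real_of_int \<bar>k i\<bar>))"
        using assms by (intro mult_le_cancel_left1[THEN iffD2] conjI impI prod_ge_1) (auto intro: add_increasing2)
      also have "\<dots> = korobov_weight s a k"
        unfolding korobov_weight_def using j by (intro prod.remove[symmetric]) auto
      finally have "real_of_int \<bar>k j\<bar> \<le> real N"
        using k' N \<open>a > 0\<close> by linarith
      then show ?thesis
        by linarith
    qed
    then show ?thesis
      using k' by (force simp: int_lattice_def PiE_iff abs_le_iff)
  qed
  then show ?thesis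
    using that by blast
qed

text \<open>Rankin's trick: each counted frequency contributes at least \<open>1\<close> to the sum of
  \<open>(T / \<lambda>\<^sub>a(k)) powr (1 + q)\<close> with \<open>T = \<epsilon> powr (- 1 / r)\<close>, which factorizes over the coordinates.\<close>

lemma card_korobov_index_set_le:
  assumes "r > 0" "a \<ge> 1" "\<epsilon> > 0" "q > 0"
  shows "finite (korobov_index_set r a s \<epsilon>)"
    and "real (card (korobov_index_set r a s \<epsilon>)) \<le>
           \<epsilon> powr (- (1 + q) / r) * (a powr (- q) * (1 / a + 2 / q)) ^ s"
proof -
  let ?A = "korobov_index_set r a s \<epsilon>"
  have "a > 0"
    using assms by simp
  obtain N :: nat where N: "?A \<subseteq> (\<Pi>\<^sub>E j\<in>{1..s}. {- int N..int N})"
    using korobov_index_set_subset_box[OF assms(1-3)] by blast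
  have fin: "finite (\<Pi>\<^sub>E j\<in>{1..s}. {- int N..int N})"
    by (intro finite_PiE) auto
  with N show "finite ?A"
    by (rule finite_subset)
  have ge_1: "1 \<le> \<epsilon> powr (- (1 + q) / r) * korobov_weight s a k powr (- (1 + q))" if "k \<in> ?A" for k
  proof -
    have pos: "korobov_weight s a k > 0"
      by (rule korobov_weight_pos[OF \<open>a > 0\<close>])
    have "korobov_weight s a k < \<epsilon> powr (- 1 / r)"
      using that korobov_index_set_iff[OF assms(1) \<open>a > 0\<close> assms(3)] by blast
    then have "(\<epsilon> powr (- 1 / r)) powr (- (1 + q)) \<le> korobov_weight s a k powr (- (1 + q))"
      using pos assms by (intro powr_mono2') auto
    then have "\<epsilon> powr (- (1 + q) / r) * (\<epsilon> powr (- 1 / r)) powr (- (1 + q))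
        \<le> \<epsilon> powr (- (1 + q) / r) * korobov_weight s a k powr (- (1 + q))"
      by (intro mult_left_mono) auto
    moreover have "\<epsilon> powr (- (1 + q) / r) * (\<epsilon> powr (- 1 / r)) powr (- (1 + q)) = 1"
      using assms by (simp add: powr_powr powr_add[symmetric] add_divide_distrib diff_divide_distrib)
    ultimately show ?thesis
      by simp
  qed
  have "real (card ?A) \<le> (\<Sum>k\<in>?A. \<epsilon> powr (- (1 + q) / r) * korobov_weight s a k powr (- (1 + q)))"
    using sum_mono[OF ge_1] by simp
  also have "\<dots> \<le> (\<Sum>k\<in>(\<Pi>\<^sub>E j\<in>{1..s}. {- int N..int N}).
      \<epsilon> powr (- (1 + q) / r) * korobov_weight s a k powr (- (1 + q)))"
    using N fin by (intro sum_mono2) auto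
  also have "\<dots> = \<epsilon> powr (- (1 + q) / r) *
      (\<Prod>j\<in>{1..s}. \<Sum>k\<in>{- int N..int N}. (a + real_of_int \<bar>k\<bar>) powr (- (1 + q)))"
    by (subst prod_sum_PiE) (simp_all add: sum_distrib_left korobov_weight_def prod_powr_distrib)
  also have "\<dots> \<le> \<epsilon> powr (- (1 + q) / r) * (\<Prod>j\<in>{1..s}. a powr (- q) * (1 / a + 2 / q))"
    using sum_int_powr_le[OF \<open>a > 0\<close> \<open>q > 0\<close>] by (intro mult_left_mono prod_mono) (auto intro: sum_nonneg)
  finally show "real (card ?A) \<le> \<epsilon> powr (- (1 + q) / r) * (a powr (- q) * (1 / a + 2 / q)) ^ s"
    by simp
qed

lemma n_eps_korobov_le:
  assumes "r > 0" "a \<ge> 1" "\<epsilon> > 0" "q > 0"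
  obtains m where "n_eps_korobov r a s \<epsilon> \<le> enat m"
    "real m \<le> \<epsilon> powr (- (1 + q) / r) * (a powr (- q) * (1 / a + 2 / q)) ^ s"
  using n_eps_korobov_le_card[OF _ assms(3) card_korobov_index_set_le(1)[OF assms]]
    card_korobov_index_set_le(2)[OF assms] assms that by fastforce

text \<open>With \<open>t\<close> fixed the bound grows like a polynomial of degree \<open>t\<close>
  in \<open>s\<close>, which defeats polynomial bounds; with \<open>t\<close> proportional to
  \<open>s\<close> it grows exponentially, which defeats weak tractability.\<close>

lemma binomial_le_n_eps_korobov:
  assumes "a > 0" "\<epsilon> > 0" "t \<le> s" and less: "((1 + a) ^ t * a ^ (s - t)) powr (- r) > \<epsilon>"
  shows "enat (s choose t) \<le> n_eps_korobov r a s \<epsilon>"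
proof -
  define ind where "ind S = restrict (\<lambda>j. if j \<in> S then 1 else 0 :: int) {1..s}" for S
  let ?P = "{S. S \<subseteq> {1..s} \<and> card S = t}"
  have inj: "inj_on ind ?P"
  proof (rule inj_onI)
    fix S S' assume S: "S \<in> ?P" "S' \<in> ?P" and eq: "ind S = ind S'"
    have "j \<in> S \<longleftrightarrow> j \<in> S'" if "j \<in> {1..s}" for j
      using fun_cong[OF eq, of j] that by (auto simp: ind_def split: if_splits)
    with S show "S = S'"
      by blast
  qed
  have "korobov_weight s a (ind S) = (1 + a) ^ t * a ^ (s - t)" if S: "S \<in> ?P" for S
  proof -
    have "korobov_weight s a (ind S) = (\<Prod>j\<in>{1..s}. if j \<in> S then 1 + a else a)"
      unfolding korobov_weight_def ind_def by (intro prod.cong) auto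
    also have "\<dots> = (\<Prod>j\<in>S. 1 + a) * (\<Prod>j\<in>{1..s}-S. a)"
      using S by (subst prod.If_cases) (auto simp: Int_absorb1 Diff_eq)
    also have "\<dots> = (1 + a) ^ t * a ^ (s - t)"
      using S by (simp add: card_Diff_subset finite_subset[of S "{1..s}"])
    finally show ?thesis .
  qed
  moreover have "ind S \<in> int_lattice s" for S
    unfolding ind_def by (rule restrict_int_lattice)
  ultimately have "ind ` ?P \<subseteq> korobov_index_set r a s \<epsilon>"
    using less by (auto simp: korobov_index_set_def)
  moreover have "finite ?P"
    by simp
  ultimately have "enat (card (ind ` ?P)) \<le> n_eps_korobov r a s \<epsilon>"
    using assms by (intro card_le_n_eps_korobov) auto
  then show ?thesis
    unfolding card_image[OF inj] by (simp add: n_subsets)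
qed

section \<open>Tractability\<close>

lemma ereal_of_enat_le:
  assumes "n \<le> enat m" "real m \<le> x"
  shows "ereal_of_enat n \<le> ereal x"
  using assms by (cases n) auto

section \<open>Exponential tractability for a > 1\<close>

lemma korobov_exp_bound:
  fixes r a q \<epsilon> :: real
  assumes "r > 0" "a > 1" "q \<ge> 2" "a - 2 / q > 1" "\<epsilon> \<in> {0<..1}"
  shows "ereal_of_enat (n_eps_korobov r a s \<epsilon>)
    \<le> ereal (q * (a - 2 / q) powr (- q * real s) * \<epsilon> powr (- (1 + q) / r))"
proof -
  let ?l = "a - 2 / q"
  have l: "?l > 0" "q > 0"
    using assms by simp_all
  obtain m where m: "n_eps_korobov r a s \<epsilon> \<le> enat m"
    "real m \<le> \<epsilon> powr (- (1 + q) / r) * (a powr (- q) * (1 / a + 2 / q)) ^ s"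
    using n_eps_korobov_le[of r a \<epsilon> q s] assms by auto
  \<comment> \<open>Prepares Bernoulli's inequality with u = 2/(a q), chosen so that a (1 - u) = a -
    2/q. The assumption \<open>q \<ge> 2\<close> lets 1 absorb \<open>2 / q\<close>.\<close>
  have "1 / a + 2 / q \<le> 1 + q * (2 / (a * q))"
  proof -
    have "q * (2 / (a * q)) = 2 / a" "2 / q \<le> 1" "1 / a \<le> 2 / a"
      using assms by (simp_all add: divide_right_mono)
    then show ?thesis
      by linarith
  qed
  also have "\<dots> \<le> (1 - 2 / (a * q)) powr (- q)"
    using assms by (intro one_minus_powr_neg_ge) (auto simp: field_simps)
  finally have "a powr (- q) * (1 / a + 2 / q) \<le> a powr (- q) * (1 - 2 / (a * q)) powr (- q)"
    by (intro mult_left_mono) auto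
  also have "\<dots> = ?l powr (- q)"
    using assms by (simp add: powr_mult[symmetric] right_diff_distrib)
  finally have "(a powr (- q) * (1 / a + 2 / q)) ^ s \<le> (?l powr (- q)) ^ s"
    using assms by (intro power_mono) auto
  also have "\<dots> = ?l powr (- q * real s)"
    using l by (simp add: powr_power mult.commute)
  finally have "real m \<le> \<epsilon> powr (- (1 + q) / r) * ?l powr (- q * real s)"
    by (intro order_trans[OF m(2)] mult_left_mono) auto
  also have "\<dots> \<le> q * (\<epsilon> powr (- (1 + q) / r) * ?l powr (- q * real s))"
    using \<open>q \<ge> 2\<close> by (intro mult_le_cancel_right1[THEN iffD2]) (auto simp: not_less)
  finally show ?thesis
    by (intro ereal_of_enat_le[OF m(1)]) (simp add: mult_ac)
qed

lemma korobov_exp_tractability_bound: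
  assumes "r > 0" "a > 1" "q \<ge> 2" "a - 2 / q > 1"
  shows "exp_tractability_bound (n_eps_korobov r a) q ((1 + q) / r) (q * ln (a - 2 / q))"
proof -
  have "(a - 2 / q) powr (- q * real s) = exp (- (q * ln (a - 2 / q)) * real s)" for s
    using assms by (simp add: powr_def mult_ac)
  note eq = this[symmetric]
  show ?thesis
    unfolding exp_tractability_bound_def eq minus_divide_left using korobov_exp_bound[OF assms] by blast
qed

lemma korobov_exponentially_tractable:
  assumes "r > 0" "a > 1"
  shows "exponentially_tractable (n_eps_korobov r a)"
    and "exp_tractability_exponent (n_eps_korobov r a) \<le> (if a \<ge> 2 then 3 / r else (1 + 2 / (a - 1)) / r)"
proof -
  \<comment> \<open>At \<open>q = 2 / (a - 1)\<close> the base \<open>a - 2 / q\<close> equals 1, so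
    every \<open>q\<close> above this maximum is admissible. The exponent belonging to the maximum
    itself is reached as a limit; for \<open>a \<ge> 2\<close> the maximum is 2.\<close>
  define q\<^sub>0 where "q\<^sub>0 = max 2 (2 / (a - 1))"
  have bound: "exp_tractability_bound (n_eps_korobov r a) q ((1 + q) / r) (q * ln (a - 2 / q))"
    "q \<ge> 2" "q * ln (a - 2 / q) > 0" if "q > q\<^sub>0" for q
  proof -
    show "q \<ge> 2"
      using that by (simp add: q\<^sub>0_def)
    moreover have "a - 2 / q > 1"
      using that assms by (auto simp: q\<^sub>0_def field_simps)
    ultimately show "exp_tractability_bound (n_eps_korobov r a) q ((1 + q) / r) (q * ln (a - 2 / q))"
      "q * ln (a - 2 / q) > 0"
      using korobov_exp_tractability_bound[OF assms] by auto
  qed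
  have "(1 + (q\<^sub>0 + 1)) / r \<ge> 0"
    using assms by (simp add: q\<^sub>0_def)
  then show "exponentially_tractable (n_eps_korobov r a)"
    unfolding exponentially_tractable_def using bound[of "q\<^sub>0 + 1"]
    by (intro exI[of _ "q\<^sub>0 + 1"] exI[of _ "(1 + (q\<^sub>0 + 1)) / r"] exI[of _ "(q\<^sub>0 + 1) * ln (a - 2 / (q\<^sub>0 + 1))"]) auto
  have "exp_tractability_exponent (n_eps_korobov r a) \<le> (1 + q\<^sub>0) / r"
  proof (rule field_le_epsilon)
    fix e :: real assume "e > 0"
    \<comment> \<open>Increasing q by \<open>e * r\<close> raises (1 + q)/r by exactly
      \<open>e\<close>.\<close>
    let ?q = "q\<^sub>0 + e * r"
    have q: "?q > q\<^sub>0"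
      using \<open>e > 0\<close> assms by simp
    have "exp_tractability_exponent (n_eps_korobov r a) \<le> (1 + ?q) / r"
      unfolding exp_tractability_exponent_def
    proof (rule cInf_lower)
      show "(1 + ?q) / r \<in> {p. p \<ge> 0 \<and> (\<exists>C q. C \<ge> 0 \<and> q > 0 \<and> exp_tractability_bound (n_eps_korobov r a) C p q)}"
        using bound[OF q] assms
        by (intro CollectI conjI exI[of _ ?q] exI[of _ "?q * ln (a - 2 / ?q)"]) auto
    qed (auto intro: bdd_belowI)
    also have "\<dots> = (1 + q\<^sub>0) / r + e"
      using assms by (simp add: field_simps)
    finally show "exp_tractability_exponent (n_eps_korobov r a) \<le> (1 + q\<^sub>0) / r + e" .
  qed
  also have "(1 + q\<^sub>0) / r = (if a \<ge> 2 then 3 / r else (1 + 2 / (a - 1)) / r)"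
    using assms by (auto simp: q\<^sub>0_def max_def field_simps)
  finally show "exp_tractability_exponent (n_eps_korobov r a) \<le> (if a \<ge> 2 then 3 / r else (1 + 2 / (a - 1)) / r)" .
qed

section \<open>Weak tractability and polynomial intractability for a = 1\<close>

lemma ln_enat_nonneg: "ln_enat n \<ge> 0"
  by (cases n) (auto simp: ln_enat_def)

lemma ln_enat_mono:
  assumes "m \<le> n"
  shows "ln_enat m \<le> ln_enat n"
proof (cases n)
  case (enat n')
  with assms obtain m' where "m = enat m'" "m' \<le> n'"
    by (cases m) auto
  with enat show ?thesis
    by (auto simp: ln_enat_def)
qed (simp add: ln_enat_def)

lemma eventually_tractability_filter:
  fixes P :: "real \<times> nat \<Rightarrow> bool"
  shows "eventually P (inf (filtercomap (\<lambda>(\<epsilon>, s). 1 / \<epsilon> + real s) at_top) (principal ({0<..1} \<times> {1..})))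
    \<longleftrightarrow> (\<exists>N. \<forall>\<epsilon>\<in>{0<..1}. \<forall>s\<ge>1. 1 / \<epsilon> + real s \<ge> N \<longrightarrow> P (\<epsilon>, s))"
  unfolding eventually_inf_principal eventually_filtercomap_at_top_linorder
  by (rule arg_cong[where f = Ex], rule ext) auto

lemma korobov_weakly_tractable:
  assumes "r > 0"
  shows "weakly_tractable (n_eps_korobov r 1)"
  unfolding weakly_tractable_def
proof (rule order_tendstoI)
  fix l :: ereal assume "l < 0"
  have "l < ln_enat (n_eps_korobov r 1 s \<epsilon>) / ereal (1 / \<epsilon> + real s)" if "\<epsilon> \<in> {0<..1}" for \<epsilon> s
    using ereal_divide_right_mono[OF ln_enat_nonneg, of "ereal (1 / \<epsilon> + real s)" "n_eps_korobov r 1 s \<epsilon>"]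
      that \<open>l < 0\<close> by (auto simp: add_pos_nonneg)
  then show "\<forall>\<^sub>F x in inf (filtercomap (\<lambda>(\<epsilon>, s). 1 / \<epsilon> + real s) at_top) (principal ({0<..1} \<times> {1..})).
      l < (case x of (\<epsilon>, s) \<Rightarrow> ln_enat (n_eps_korobov r 1 s \<epsilon>) / ereal (1 / \<epsilon> + real s))"
    unfolding eventually_tractability_filter by auto
next
  fix u :: ereal assume "0 < u"
  then obtain \<delta> where \<delta>: "\<delta> > 0" "ereal \<delta> < u"
    using ereal_dense2[of 0 u] by auto
  \<comment> \<open>Then \<open>2 / q\<close> is \<open>\<delta> / 2\<close>, so the factor (1 +
    2/q)^s costs at most half of \<open>\<delta>\<close> per unit of \<open>s\<close>. As
    \<open>q\<close> depends on \<open>\<delta>\<close> alone, the term in ln (1/\<epsilon>) fits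
    into the other half once 1/\<epsilon> + s is large.\<close>
  define q where "q = 4 / \<delta>"
  have "q > 0"
    using \<delta> by (simp add: q_def)
  have "((\<lambda>y. (1 + q) / r * (ln y / y)) \<longlongrightarrow> (1 + q) / r * 0) at_top"
    by (intro tendsto_intros ln_x_over_x_tendsto_0)
  then have "\<forall>\<^sub>F y in at_top. (1 + q) / r * (ln y / y) < \<delta> / 2"
    using \<delta> by (intro order_tendstoD) auto
  then obtain N where N: "\<And>y. y \<ge> N \<Longrightarrow> (1 + q) / r * (ln y / y) < \<delta> / 2"
    by (auto simp: eventually_at_top_linorder)
  have "ln_enat (n_eps_korobov r 1 s \<epsilon>) / ereal (1 / \<epsilon> + real s) < u"
    if \<epsilon>: "\<epsilon> \<in> {0<..1}" and ge: "1 / \<epsilon> + real s \<ge> N" for \<epsilon> s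
  proof -
    let ?y = "1 / \<epsilon> + real s"
    have y: "?y \<ge> 1 / \<epsilon>" "1 / \<epsilon> \<ge> 1"
      using \<epsilon> by auto
    then have y_pos: "?y > 0"
      by linarith
    obtain m where m: "n_eps_korobov r 1 s \<epsilon> \<le> enat m"
      "real m \<le> \<epsilon> powr (- (1 + q) / r) * (1 powr (- q) * (1 / 1 + 2 / q)) ^ s"
      using n_eps_korobov_le[of r 1 \<epsilon> q s] assms \<epsilon> \<open>q > 0\<close> by auto
    have "(if m = 0 then 0 else ln (real m)) \<le> (1 + q) / r * ln ?y + ?y * (\<delta> / 2)"
    proof (cases "m = 0")
      case True
      then show ?thesis
        using y y_pos assms \<open>q > 0\<close> \<delta> by auto
    next
      case False
      have pos: "1 + 2 / q > 0"
        using \<open>q > 0\<close> by (simp add: add_pos_pos)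
      from False have "ln (real m) \<le> ln (\<epsilon> powr (- (1 + q) / r) * (1 + 2 / q) ^ s)"
        using m(2) by (subst ln_le_cancel_iff) (auto intro: less_le_trans)
      also have "\<dots> = (1 + q) / r * ln (1 / \<epsilon>) + real s * ln (1 + 2 / q)"
        using \<epsilon> pos by (simp add: ln_mult ln_powr ln_realpow ln_div add_pos_pos)
            (simp add: algebra_simps diff_divide_distrib add_divide_distrib)
      also have "\<dots> \<le> (1 + q) / r * ln ?y + ?y * (2 / q)"
      proof (intro add_mono mult_left_mono mult_mono)
        show "ln (1 / \<epsilon>) \<le> ln ?y"
          using y \<epsilon> by (intro ln_mono) auto
        show "ln (1 + 2 / q) \<le> 2 / q"
          using \<open>q > 0\<close> by (intro ln_add_one_self_le_self) auto
      qed (use \<epsilon> assms \<open>q > 0\<close> y_pos in auto)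
      finally show ?thesis
        using False \<delta> by (simp add: q_def)
    qed
    then have "ln_enat (n_eps_korobov r 1 s \<epsilon>) \<le> ereal ((1 + q) / r * ln ?y + ?y * (\<delta> / 2))"
      using ln_enat_mono[OF m(1)] by (auto simp: ln_enat_def intro: order_trans)
    then have "ln_enat (n_eps_korobov r 1 s \<epsilon>) / ereal ?y \<le> ereal ((1 + q) / r * ln ?y + ?y * (\<delta> / 2)) / ereal ?y"
      using y_pos by (intro ereal_divide_right_mono) auto
    also have "\<dots> = ereal (((1 + q) / r * ln ?y + ?y * (\<delta> / 2)) / ?y)"
      using y_pos by simp
    also have "((1 + q) / r * ln ?y + ?y * (\<delta> / 2)) / ?y = (1 + q) / r * (ln ?y / ?y) + \<delta> / 2"
    proof -
      have *: "(c * u + z * v) / z = c * (u / z) + v" if "z > 0" for c u v z :: real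
        using that by (simp add: field_simps)
      show ?thesis
        by (rule *[OF y_pos])
    qed
    also have "\<dots> < ereal \<delta>"
    proof -
      have "(1 + q) / r * (ln ?y / ?y) + \<delta> / 2 < \<delta>"
        using N[OF ge] by linarith
      then show ?thesis
        by (simp only: less_ereal.simps)
    qed
    finally show ?thesis
      using \<delta>(2) by order
  qed
  then show "\<forall>\<^sub>F x in inf (filtercomap (\<lambda>(\<epsilon>, s). 1 / \<epsilon> + real s) at_top) (principal ({0<..1} \<times> {1..})).
      (case x of (\<epsilon>, s) \<Rightarrow> ln_enat (n_eps_korobov r 1 s \<epsilon>) / ereal (1 / \<epsilon> + real s)) < u"
    unfolding eventually_tractability_filter by (intro exI[of _ N]) auto
qed

lemma korobov_polynomially_intractable:
  assumes "r > 0"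
  shows "polynomially_intractable (n_eps_korobov r 1)"
  unfolding polynomially_intractable_def
proof
  assume "polynomially_tractable (n_eps_korobov r 1)"
  then obtain C p q where "C \<ge> 0" "q \<ge> 0"
    and bound: "\<And>\<epsilon> s. \<epsilon> \<in> {0<..1} \<Longrightarrow> s \<ge> 1 \<Longrightarrow>
      ereal_of_enat (n_eps_korobov r 1 s \<epsilon>) \<le> ereal (C * real s powr q * \<epsilon> powr (- p))"
    unfolding polynomially_tractable_def by blast
  obtain t :: nat where t: "q \<le> real t"
    using real_arch_simple by blast
  \<comment> \<open>The binomial coefficient has degree \<open>m\<close> in \<open>s\<close>, one
    more than \<open>t \<ge> q\<close>. For \<open>a = 1\<close> the weight of \<open>m\<close> ones
    is 2^m whatever \<open>s\<close> is, and the extra factor 2^(-r) in \<open>\<epsilon>\<close>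
    makes the comparison strict.\<close>
  define m where "m = Suc t"
  define \<epsilon> where "\<epsilon> = 2 powr (- r * real (Suc m))"
  define D where "D = C * \<epsilon> powr (- p)"
  have \<epsilon>: "\<epsilon> \<in> {0<..1}"
  proof -
    have "\<epsilon> \<le> 2 powr 0"
      unfolding \<epsilon>_def using assms by (intro powr_mono) auto
    then show ?thesis
      by (simp add: \<epsilon>_def)
  qed
  have le: "real s \<le> D * real m ^ m" if s: "s \<ge> m" for s
  proof -
    have s1: "s \<ge> 1"
      using s by (simp add: m_def)
    have "\<epsilon> < 2 powr (- r * real m)"
      using assms by (simp add: \<epsilon>_def)
    also have "\<dots> = (2 ^ m) powr (- r)"
      by (simp add: powr_powr powr_realpow[symmetric] mult.commute)
    finally have "enat (s choose m) \<le> n_eps_korobov r 1 s \<epsilon>"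
      using s \<epsilon> by (intro binomial_le_n_eps_korobov) auto
    then have "ereal (real (s choose m)) \<le> ereal_of_enat (n_eps_korobov r 1 s \<epsilon>)"
      by (cases "n_eps_korobov r 1 s \<epsilon>") auto
    with bound[OF \<epsilon> s1] have "real (s choose m) \<le> C * real s powr q * \<epsilon> powr (- p)"
      by (metis ereal_less_eq(3) order_trans)
    also have "\<dots> = D * real s powr q"
      by (simp add: D_def)
    also have "\<dots> \<le> D * real s powr real t"
      using \<open>C \<ge> 0\<close> t s1 by (intro mult_left_mono powr_mono) (auto simp: D_def)
    also have "real s powr real t = real s ^ t"
      using s1 by (intro powr_realpow) auto
    finally have "(real s / real m) ^ m \<le> D * real s ^ t"
      using binomial_ge_n_over_k_pow_k[OF s, where ?'a = real] by linarith
    then have "real s ^ m \<le> D * real s ^ t * real m ^ m"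
      by (simp add: power_divide divide_le_eq m_def)
    then have "real s ^ t * real s \<le> real s ^ t * (D * real m ^ m)"
      by (simp add: m_def algebra_simps)
    then show ?thesis
      using s1 by (subst (asm) mult_le_cancel_left_pos) auto
  qed
  obtain s where "D * real m ^ m < real s"
    using reals_Archimedean2 by blast
  with le[of "max s m"] show False
    by simp
qed

section \<open>Intractability for a < 1\<close>

lemma korobov_intractable:
  assumes "r > 0" "a > 0" "a < 1"
  shows "intractable (n_eps_korobov r a)"
  unfolding intractable_def
proof
  assume "weakly_tractable (n_eps_korobov r a)"
  have "(\<lambda>n. (1 + a) * a ^ n) \<longlonglongrightarrow> (1 + a) * 0"
    using assms by (intro tendsto_intros LIMSEQ_realpow_zero) auto
  then have "\<forall>\<^sub>F n in sequentially. (1 + a) * a ^ n < 1"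
    by (intro order_tendstoD) auto
  then obtain n\<^sub>0 where "\<And>n. n \<ge> n\<^sub>0 \<Longrightarrow> (1 + a) * a ^ n < 1"
    by (auto simp: eventually_sequentially)
  \<comment> \<open>\<open>n\<close> zero coordinates outweigh one coordinate equal to 1. Requiring
    \<open>n \<ge> 1\<close> gives \<open>M \<ge> 2\<close>, so that \<open>ln (real M)\<close> is
    positive.\<close>
  then obtain n where n: "(1 + a) * a ^ n < 1" "n \<ge> 1"
    using that[of "max n\<^sub>0 1"] by simp
  define M where "M = Suc n"
  \<comment> \<open>The contradiction threshold: the logarithm is at least
    \<open>t * ln (real M)\<close>, while the denominator 1 + s is at most 2 s with s = M t.\<close>
  define c where "c = ln (real M) / (2 * real M)"
  have "c > 0"
    using n by (simp add: c_def M_def)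
  then have "\<forall>\<^sub>F x in inf (filtercomap (\<lambda>(\<epsilon>, s). 1 / \<epsilon> + real s) at_top) (principal ({0<..1} \<times> {1..})).
      (case x of (\<epsilon>, s) \<Rightarrow> ln_enat (n_eps_korobov r a s \<epsilon>) / ereal (1 / \<epsilon> + real s)) < ereal c"
    using \<open>weakly_tractable (n_eps_korobov r a)\<close> unfolding weakly_tractable_def
    by (intro order_tendstoD) auto
  then obtain N where "\<forall>\<epsilon>\<in>{0<..1}. \<forall>s\<ge>1. 1 / \<epsilon> + real s \<ge> N \<longrightarrow>
      ln_enat (n_eps_korobov r a s \<epsilon>) / ereal (1 / \<epsilon> + real s) < ereal c"
    unfolding eventually_tractability_filter by auto
  note N = this[rule_format]
  obtain t' :: nat where "N \<le> real t'"
    using real_arch_simple by blast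
  define t where "t = Suc t'"
  have t: "t \<noteq> 0"
    by (simp add: t_def)
  \<comment> \<open>Each of the \<open>t\<close> ones is matched with \<open>n\<close> zeros, which
    keeps the weight below 1. Hence \<open>\<epsilon> = 1\<close> suffices, and 1/\<epsilon> + s
    tends to infinity through \<open>s\<close> alone.\<close>
  define s where "s = M * t"
  have ts: "t \<le> s" "s - t = n * t" "s \<ge> 1"
    by (auto simp: s_def M_def t_def)
  have "(1 + a) ^ t * a ^ (s - t) = ((1 + a) * a ^ n) ^ t"
    by (simp add: ts power_mult power_mult_distrib)
  also have "\<dots> < 1"
    using n assms by (intro power_Suc_less_one[of _ t', folded t_def]) auto
  finally have "1 powr (- r) < ((1 + a) ^ t * a ^ (s - t)) powr (- r)"
    using assms by (intro powr_less_mono2_neg) auto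
  then have "enat (s choose t) \<le> n_eps_korobov r a s 1"
    using assms ts by (intro binomial_le_n_eps_korobov) auto
  then have "ln_enat (enat (s choose t)) \<le> ln_enat (n_eps_korobov r a s 1)"
    by (rule ln_enat_mono)
  moreover have "ereal (real t * ln (real M)) \<le> ln_enat (enat (s choose t))"
  proof -
    have "real M ^ t = (real s / real t) ^ t"
      using t by (simp add: s_def)
    also have "\<dots> \<le> real (s choose t)"
      by (rule binomial_ge_n_over_k_pow_k[OF ts(1)])
    finally have "ln (real M ^ t) \<le> ln (real (s choose t))"
      by (subst ln_le_cancel_iff) (auto simp: M_def ts)
    moreover have "s choose t \<noteq> 0"
      using ts by simp
    ultimately show ?thesis
      by (simp add: ln_enat_def ln_realpow M_def)
  qed
  ultimately have "ereal (real t * ln (real M)) / ereal (1 / 1 + real s)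
      \<le> ln_enat (n_eps_korobov r a s 1) / ereal (1 / 1 + real s)"
    by (intro ereal_divide_right_mono) auto
  also have "\<dots> < ereal c"
  proof (rule N)
    have "real t \<le> real s"
      using ts by simp
    then show "N \<le> 1 / 1 + real s"
      using \<open>N \<le> real t'\<close> by (simp add: t_def)
  qed (use ts in auto)
  finally have "real t * ln (real M) / (1 + real s) < c"
    by simp
  moreover have "c = real t * ln (real M) / (2 * real s)"
    using t by (simp add: c_def s_def)
  moreover have "real t * ln (real M) / (2 * real s) \<le> real t * ln (real M) / (1 + real s)"
    using ts by (intro divide_left_mono mult_nonneg_nonneg) (auto simp: M_def)
  ultimately show False
    by simp
qed

theorem theorem4p8:
  fixes r a :: real
  assumes "r > 0" and "a > 0"
  shows
    "(a > 1 \<longrightarrow>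
        exponentially_tractable (n_eps_korobov r a) \<and>
        (\<forall>(q::real) (s::nat) (\<epsilon>::real).
           q \<ge> 2 \<longrightarrow> a - 2 / q > 1 \<longrightarrow> s \<ge> 1 \<longrightarrow> \<epsilon> \<in> {0<..1} \<longrightarrow>
           ereal_of_enat (n_eps_korobov r a s \<epsilon>)
             \<le> ereal (q * (a - 2 / q) powr (- q * real s) * \<epsilon> powr (- (1 + q) / r))) \<and>
        exp_tractability_exponent (n_eps_korobov r a)
          \<le> (if a \<ge> 2 then 3 / r else (1 + 2 / (a - 1)) / r)) \<and>
     (a = 1 \<longrightarrow>
        weakly_tractable (n_eps_korobov r a) \<and>
        polynomially_intractable (n_eps_korobov r a)) \<and>
     (a < 1 \<longrightarrow> intractable (n_eps_korobov r a))"
  using korobov_exponentially_tractable[OF assms(1)] korobov_exp_bound[OF assms(1)]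
    korobov_weakly_tractable[OF assms(1)] korobov_polynomially_intractable[OF assms(1)]
    korobov_intractable[OF assms]
  by blast

end
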